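(* Let $q > 4\cdot 10^5$ be an integer and let $\chi$ be an even primitive real Dirichlet character modulo $q$. Then $$L(1,\chi) \geq \frac{12.52}{\sqrt{q}} .$$
   Context: A Dirichlet character $\chi$ is even if $\chi(-1)=1$, and real if it takes only real values. For a non-principal Dirichlet character $\chi$, $L(1,\chi)=\sum_{n=1}^{\infty}\chi(n)n^{-1}$. *)

theory Defs
  imports "HOL-Analysis.Analysis" "HOL-Number_Theory.Number_Theory"
begin

text \<open>
  Characters are extended by zero to all integers; the domain is \<^typ>\<open>int\<close> rather than
  \<^typ>\<open>nat\<close> so that the parity condition refers to the value at -1 directly. The equation
  \<open>chi 1 = 1\<close> follows from multiplicativity and \<open>chi 1 \<noteq> 0\<close>.
\<close>

definition dirichlet_character :: "nat \<Rightarrow> (int \<Rightarrow> complex) \<Rightarrow> bool" where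
  "dirichlet_character q chi \<longleftrightarrow>
     q > 0 \<and>
     (\<forall>a. chi (a + int q) = chi a) \<and>
     (\<forall>a b. chi (a * b) = chi a * chi b) \<and>
     (\<forall>a. chi a \<noteq> 0 \<longleftrightarrow> coprime a (int q))"

definition induced_by :: "nat \<Rightarrow> (int \<Rightarrow> complex) \<Rightarrow> nat \<Rightarrow> (int \<Rightarrow> complex) \<Rightarrow> bool" where
  "induced_by q chi d psi \<longleftrightarrow>
     d dvd q \<and> dirichlet_character d psi \<and> (\<forall>a. coprime a (int q) \<longrightarrow> chi a = psi a)"

definition primitive_character :: "nat \<Rightarrow> (int \<Rightarrow> complex) \<Rightarrow> bool" where
  "primitive_character q chi \<longleftrightarrow>
     dirichlet_character q chi \<and> \<not> (\<exists>d psi. d < q \<and> induced_by q chi d psi)"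

definition even_character :: "(int \<Rightarrow> complex) \<Rightarrow> bool" where
  "even_character chi \<longleftrightarrow> chi (-1) = 1"

definition real_character :: "(int \<Rightarrow> complex) \<Rightarrow> bool" where
  "real_character chi \<longleftrightarrow> (\<forall>a. chi a \<in> \<real>)"

text \<open>
  The value \<open>L(1, chi)\<close> for non-principal \<open>chi\<close>. The series converges only conditionally, so it is an
  ordered sum over \<open>n + 1\<close> for \<open>n = 0, 1, 2, \<dots>\<close>; for principal \<open>chi\<close> it diverges and the
  value is meaningless.
\<close>

definition L_one :: "(int \<Rightarrow> complex) \<Rightarrow> complex" where
  "L_one chi = (\<Sum>n. chi (int (Suc n)) / of_nat (Suc n))"

end

theory Submission
  imports Defs
begin

text \<open>
  Put \<open>\<zeta> = exp (2 \<pi> i / q)\<close>. As \<open>\<chi>\<close> is real, even and primitive, its Gauss sum \<open>\<tau>\<close> satisfies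
  \<open>\<tau>\<^sup>2 = q\<close> and \<open>\<tau> L(1, \<chi>) = - (\<Sum>a. \<chi>(a) ln \<bar>1 - \<zeta>\<^sup>a\<bar>)\<close>. Instead of invoking the class number
  formula, fix an odd \<open>g\<close> with \<open>\<chi>(g) = -1\<close> and let
  \<open>\<theta> = (\<Prod>a. sin (\<pi> g a / q) / sin (\<pi> a / q))\<close>, where \<open>0 < a < q / 2\<close> and \<open>\<chi>(a) = 1\<close>. Then
  \<open>2 ln \<bar>\<theta>\<bar> = \<tau> L(1, \<chi>)\<close>, and \<open>\<theta>\<close> is a unit of \<open>\<int>[\<zeta>]\<close> fixed by every \<open>\<zeta> \<mapsto> \<zeta>\<^sup>t\<close> with
  \<open>\<chi>(t) = 1\<close>; the other automorphisms send it to \<open>\<theta>' = \<plusminus> 1 / \<theta>\<close>. Using only half of the residues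
  is essential: the full product is \<open>\<theta>\<^sup>2\<close> and would lose a factor 2 in the final bound. Now \<open>\<theta> + \<theta>'\<close> is
  an integer, and \<open>\<theta> - \<theta>'\<close> is a rational multiple of \<open>\<tau>\<close>; because \<open>q\<close> is a fundamental discriminant,
  the multiple is an integer. It is not zero since \<open>L(1, \<chi>) > 0\<close>. Hence
  \<open>\<surd>q \<le> \<bar>\<theta>\<bar> + 1 / \<bar>\<theta>\<bar>\<close>, so that \<open>\<surd>q L(1, \<chi>) \<ge> 2 ln (\<surd>q - 1)\<close>.
\<close>

section \<open>Bounds for series\<close>

text \<open>Abel summation. A block of consecutive values of \<open>f\<close> is a difference of two
  partial sums, which is where the factor 2 comes from.\<close>

lemma abel_summation_bound:
  fixes f b :: "nat \<Rightarrow> real"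
  assumes C: "\<And>n. \<bar>\<Sum>k<n. f k\<bar> \<le> C"
    and dec: "\<And>k. b (Suc k) \<le> b k" and nonneg: "\<And>k. b k \<ge> 0" and mn: "m \<le> n"
  shows "\<bar>\<Sum>k=m..<n. f k * b k\<bar> \<le> 2 * C * b m"
proof -
  define T where "T n = (\<Sum>k=m..<n. f k)" for n
  have T: "\<bar>T n\<bar> \<le> 2 * C" if "m \<le> n" for n
  proof -
    have "T n = (\<Sum>k<n. f k) - (\<Sum>k<m. f k)"
      unfolding T_def using sum.atLeastLessThan_concat[of 0 m n f] that
      by (simp add: atLeast0LessThan)
    then show ?thesis using C[of n] C[of m] by linarith
  qed
  \<comment> \<open>The boundary term \<open>T n * b n\<close> is kept apart, so that the remaining
    error telescopes to \<open>b m - b n\<close>.\<close>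
  have "\<bar>(\<Sum>k=m..<n. f k * b k) - T n * b n\<bar> \<le> 2 * C * (b m - b n)"
    using mn
  proof (induction n rule: dec_induct)
    case (step n)
    have "(\<Sum>k=m..<Suc n. f k * b k) - T (Suc n) * b (Suc n)
      = ((\<Sum>k=m..<n. f k * b k) - T n * b n) + T (Suc n) * (b n - b (Suc n))"
      using step.hyps by (simp add: T_def algebra_simps)
    moreover have "\<bar>T (Suc n) * (b n - b (Suc n))\<bar> \<le> 2 * C * (b n - b (Suc n))"
      using T[of "Suc n"] step.hyps dec[of n] by (simp add: abs_mult mult_right_mono)
    ultimately show ?case using step.IH by (simp add: algebra_simps)
  qed (simp add: T_def)
  moreover have "\<bar>T n * b n\<bar> \<le> 2 * C * b n"
    using T[OF mn] nonneg[of n] by (simp add: abs_mult mult_right_mono)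
  ultimately show ?thesis by (simp add: algebra_simps)
qed

text \<open>Dirichlet's test. The explicit bound matters in \<open>L_pos\<close>, where the weights
  depend on \<open>x\<close> but \<open>C\<close> does not.\<close>

lemma summable_bounded_partial_sums:
  fixes f b :: "nat \<Rightarrow> real"
  assumes C: "\<And>n. \<bar>\<Sum>k<n. f k\<bar> \<le> C"
    and dec: "\<And>k. b (Suc k) \<le> b k" and nonneg: "\<And>k. b k \<ge> 0" and lim: "b \<longlonglongrightarrow> 0"
  shows "summable (\<lambda>k. f k * b k)" and "\<bar>\<Sum>k. f k * b k\<bar> \<le> 2 * C * b 0"
proof -
  show sm: "summable (\<lambda>k. f k * b k)"
  proof (subst summable_Cauchy, intro allI impI)
    fix \<epsilon> :: real assume "\<epsilon> > 0"
    have "(\<lambda>n. 2 * C * b n) \<longlonglongrightarrow> 0" using tendsto_mult_right_zero[OF lim] by simp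
    then obtain N where N: "\<And>n. n \<ge> N \<Longrightarrow> \<bar>2 * C * b n\<bar> < \<epsilon>"
      using \<open>\<epsilon> > 0\<close> by (auto simp: LIMSEQ_iff)
    show "\<exists>N. \<forall>m\<ge>N. \<forall>n. norm (\<Sum>k=m..<n. f k * b k) < \<epsilon>"
    proof (intro exI allI impI)
      fix m n assume "m \<ge> N"
      show "norm (\<Sum>k=m..<n. f k * b k) < \<epsilon>"
      proof (cases "m \<le> n")
        case True
        then show ?thesis
          using abel_summation_bound[of f C b m n, OF C dec nonneg] N[OF \<open>m \<ge> N\<close>] by simp
      qed (use \<open>\<epsilon> > 0\<close> in simp)
    qed
  qed
  show "\<bar>\<Sum>k. f k * b k\<bar> \<le> 2 * C * b 0"
  proof (rule LIMSEQ_le_const2)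
    show "(\<lambda>n. \<bar>\<Sum>k<n. f k * b k\<bar>) \<longlonglongrightarrow> \<bar>\<Sum>k. f k * b k\<bar>"
      by (intro tendsto_rabs summable_LIMSEQ sm)
    show "\<exists>N. \<forall>n\<ge>N. \<bar>\<Sum>k<n. f k * b k\<bar> \<le> 2 * C * b 0"
      using abel_summation_bound[of f C b 0, OF C dec nonneg] by (auto simp: atLeast0LessThan)
  qed
qed

text \<open>Abel's limit theorem. On the unit interval the weights \<open>x ^ Suc k / Suc k\<close>
  decrease in \<open>k\<close>, so Abel summation bounds the tails by \<open>2 * C / Suc m\<close>
  independently of \<open>x\<close>. Convergence is therefore uniform and the limit is continuous up
  to 1.\<close>

lemma power_series_tendsto_at_left_1:
  fixes f :: "nat \<Rightarrow> real"
  assumes C: "\<And>n. \<bar>\<Sum>k<n. f k\<bar> \<le> C"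
  shows "((\<lambda>x. \<Sum>k. f k * (x ^ Suc k / Suc k)) \<longlongrightarrow> (\<Sum>k. f k * (1 / Suc k))) (at_left 1)"
proof -
  define F where "F n x = (\<Sum>k<n. f k * (x ^ Suc k / Suc k))" for n and x :: real
  have C0: "C \<ge> 0" using C[of 0] by simp
  have dec: "x ^ Suc (Suc k) / Suc (Suc k) \<le> x ^ Suc k / Suc k" if "x \<in> {0..1}" for x :: real and k
    using that by (intro frac_le) (auto intro: mult_left_le_one_le)
  have bound: "\<bar>F n x - F m x\<bar> \<le> 2 * C / Suc m" if "m \<le> n" "x \<in> {0..1}" for m n x
  proof -
    have "F n x - F m x = (\<Sum>k=m..<n. f k * (x ^ Suc k / Suc k))"
      unfolding F_def using sum.atLeastLessThan_concat[of 0 m n "\<lambda>k. f k * (x ^ Suc k / Suc k)"] that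
      by (simp add: atLeast0LessThan)
    also have "\<bar>\<dots>\<bar> \<le> 2 * C * (x ^ Suc m / Suc m)"
      using that dec by (intro abel_summation_bound C) auto
    also have "\<dots> \<le> 2 * C * (1 / Suc m)"
      using that C0 by (intro mult_left_mono divide_right_mono power_le_one) auto
    finally show ?thesis by simp
  qed
  have "uniformly_Cauchy_on {0..1} F"
  proof (rule uniformly_Cauchy_onI')
    fix \<epsilon> :: real assume "\<epsilon> > 0"
    obtain M :: nat where M: "2 * C / \<epsilon> < M" using reals_Archimedean2 by blast
    have M': "2 * C / Suc m < \<epsilon>" if "m \<ge> M" for m
    proof -
      have "2 * C / \<epsilon> < Suc m" using M that by linarith
      then show ?thesis using \<open>\<epsilon> > 0\<close> by (simp add: field_simps)
    qed
    show "\<exists>M. \<forall>x\<in>{0..1}. \<forall>m\<ge>M. \<forall>n>m. dist (F m x) (F n x) < \<epsilon>"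
    proof (intro exI ballI allI impI)
      fix x m n assume "x \<in> {0..1::real}" "m \<ge> M" "n > m"
      then show "dist (F m x) (F n x) < \<epsilon>"
        using bound[of m n x] M'[of m] by (simp add: dist_real_def abs_minus_commute)
    qed
  qed
  then have "uniformly_convergent_on {0..1} F" by (rule Cauchy_uniformly_convergent)
  then obtain l where l: "uniform_limit {0..1} F l sequentially"
    by (auto simp: uniformly_convergent_on_def)
  have "continuous_on {0..1} l"
    by (rule uniform_limit_theorem[OF _ l]) (auto simp: F_def intro!: always_eventually continuous_intros)
  then have "(l \<longlongrightarrow> l 1) (at 1 within {0..1})" by (simp add: continuous_on_def)
  then have lim: "(l \<longlongrightarrow> l 1) (at_left 1)" by (simp add: at_within_Icc_at_left)
  have l_eq: "l x = (\<Sum>k. f k * (x ^ Suc k / Suc k))" if "x \<in> {0..1}" for x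
    using tendsto_uniform_limitI[OF l that] unfolding F_def
    by (auto simp: sums_def[symmetric] sums_iff)
  have "eventually (\<lambda>x. x \<in> {0<..<1}) (at_left (1::real))"
    by (rule eventually_at_leftI[of 0]) auto
  then have "\<forall>\<^sub>F x in at_left 1. l x = (\<Sum>k. f k * (x ^ Suc k / Suc k))"
    by eventually_elim (use l_eq in auto)
  then show ?thesis using lim l_eq[of 1] by (simp add: tendsto_cong)
qed

text \<open>Pairing \<open>x ^ i\<close> with \<open>x ^ (n - i)\<close>, the AM-GM inequality
  bounds a geometric sum below by its length times the middle power of \<open>y = sqrt x\<close>.
  Multiplying two consecutive bounds gives the power \<open>y ^ (2 * n - 1)\<close>, which is at
  least \<open>x ^ n\<close> because \<open>y \<le> 1\<close>.\<close>

lemma power_le_geometric_sums: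
  fixes x :: real
  assumes x: "0 \<le> x" "x \<le> 1"
  shows "real n * real (Suc n) * x ^ n \<le> (\<Sum>i<n. x ^ i) * (\<Sum>i<Suc n. x ^ i)"
proof -
  define y where "y = sqrt x"
  have y: "0 \<le> y" "y \<le> 1" "x = y ^ 2" using x by (auto simp: y_def)
  have avg: "real (Suc n) * y ^ n \<le> (\<Sum>i<Suc n. x ^ i)" for n
  proof -
    have "2 * y ^ n \<le> x ^ i + x ^ (n - i)" if "i \<le> n" for i
    proof -
      have "0 \<le> (y ^ i - y ^ (n - i)) ^ 2" by simp
      also have "\<dots> = x ^ i + x ^ (n - i) - 2 * (y ^ i * y ^ (n - i))"
        by (simp add: power2_diff y(3) power_mult[symmetric] mult.commute)
      also have "y ^ i * y ^ (n - i) = y ^ n" using that by (simp flip: power_add)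
      finally show ?thesis by simp
    qed
    then have "(\<Sum>i<Suc n. 2 * y ^ n) \<le> (\<Sum>i<Suc n. x ^ i + x ^ (n - i))"
      by (intro sum_mono) auto
    also have "\<dots> = 2 * (\<Sum>i<Suc n. x ^ i)"
      using sum.nat_diff_reindex[of "\<lambda>i. x ^ i" "Suc n"] by (simp add: sum.distrib)
    finally show ?thesis by simp
  qed
  show ?thesis
  proof (cases n)
    case (Suc m)
    have "real n * real (Suc n) * x ^ n \<le> (real n * y ^ m) * (real (Suc n) * y ^ n)"
    proof -
      have "x ^ n = y ^ (2 * n)" by (simp add: y power_mult)
      also have "\<dots> \<le> y ^ (m + n)" using y Suc by (intro power_decreasing) auto
      finally have "real n * real (Suc n) * x ^ n \<le> real n * real (Suc n) * y ^ (m + n)"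
        by (intro mult_left_mono) auto
      then show ?thesis by (simp add: power_add mult_ac)
    qed
    also have "\<dots> \<le> (\<Sum>i<n. x ^ i) * (\<Sum>i<Suc n. x ^ i)"
      unfolding Suc by (intro mult_mono avg) (use x y in \<open>auto intro!: sum_nonneg add_nonneg_nonneg\<close>)
    finally show ?thesis .
  qed simp
qed

text \<open>The monotonicity behind Monsky's proof that \<open>L(1, \<chi>) \<noteq> 0\<close>.\<close>

lemma monsky_decreasing:
  fixes x :: real
  assumes x: "0 < x" "x < 1" and n: "n > 0"
  defines "b \<equiv> \<lambda>n::nat. 1 / (real n * (1 - x)) - x ^ n / (1 - x ^ n)"
  shows "b (Suc n) \<le> b n" and "b n \<ge> 0"
proof -
  define s where "s n = (\<Sum>i<n. x ^ i)" for n
  have s: "1 - x ^ n = (1 - x) * s n" for n using x by (simp add: s_def sum_gp_strict)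
  have s_pos: "s n > 0" if "n > 0" for n unfolding s_def using x that by (intro sum_pos) auto
  have s_Suc: "s (Suc n) = 1 + x * s n"
    unfolding s_def sum.lessThan_Suc_shift by (simp add: sum_distrib_left)
  have eq: "(1 - x) * b n = 1 / real n - x ^ n / s n" if "n > 0" for n
  proof -
    have "(1 - x) * (1 / (real n * (1 - x))) = 1 / real n" using x by simp
    moreover have "(1 - x) * (x ^ n / ((1 - x) * s n)) = x ^ n / s n" using x by simp
    ultimately show ?thesis by (simp only: b_def s right_diff_distrib)
  qed
  \<comment> \<open>After multiplication by \<open>1 - x\<close>, monotonicity of \<open>b\<close>
    becomes a comparison of the two terms on the right, which \<open>power_le_geometric_sums\<close>
    decides.\<close>
  have "1 / real n - x ^ n / s n - (1 / real (Suc n) - x ^ Suc n / s (Suc n))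
      = 1 / (real n * real (Suc n)) - x ^ n / (s n * s (Suc n))"
  proof -
    have "1 / real n - 1 / real (Suc n) = 1 / (real n * real (Suc n))"
      using n by (simp add: field_simps)
    moreover have "x ^ n / s n - x ^ Suc n / s (Suc n) = x ^ n / (s n * s (Suc n))"
    proof -
      have "x ^ n / s n - x ^ Suc n / s (Suc n) = x ^ n * (s (Suc n) - x * s n) / (s n * s (Suc n))"
        using s_pos[OF n] s_pos[of "Suc n"] by (simp add: field_simps)
      then show ?thesis by (simp add: s_Suc)
    qed
    ultimately show ?thesis by linarith
  qed
  moreover have "x ^ n / (s n * s (Suc n)) \<le> 1 / (real n * real (Suc n))"
  proof -
    have "real n * real (Suc n) * x ^ n \<le> s n * s (Suc n)"
      unfolding s_def using power_le_geometric_sums[of x n] x by simp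
    then show ?thesis using n s_pos[OF n] s_pos[of "Suc n"]
      by (simp add: divide_simps mult_ac del: of_nat_Suc)
  qed
  ultimately have "(1 - x) * b (Suc n) \<le> (1 - x) * b n"
    unfolding eq[OF n] eq[OF zero_less_Suc] by linarith
  then show "b (Suc n) \<le> b n" using x by simp
  have "real n * x ^ n = (\<Sum>i<n. x ^ n)" by simp
  also have "\<dots> \<le> s n" unfolding s_def using x by (intro sum_mono power_decreasing) auto
  finally have "x ^ n / s n \<le> 1 / real n" using n s_pos[OF n] by (simp add: field_simps)
  then have "(1 - x) * b n \<ge> 0" unfolding eq[OF n] by simp
  then show "b n \<ge> 0" using x by (simp add: zero_le_mult_iff)
qed

section \<open>Divisor sums of completely multiplicative functions\<close>

text \<open>Every divisor of \<open>p ^ k * m\<close> is uniquely \<open>p ^ i * d\<close> with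
  \<open>d dvd m\<close>; the multiplicity of \<open>p\<close> recovers \<open>i\<close>.\<close>

lemma sum_divisors_prime_power_mult:
  fixes f :: "nat \<Rightarrow> 'a :: comm_semiring_1"
  assumes p: "prime p" "\<not> p dvd m" and m: "m > 0"
    and f: "\<And>a b. f (a * b) = f a * f b" "f 1 = 1"
  shows "(\<Sum>d | d dvd p ^ k * m. f d) = (\<Sum>i\<le>k. f p ^ i) * (\<Sum>d | d dvd m. f d)"
proof -
  have f_pow: "f (p ^ i) = f p ^ i" for i by (induction i) (simp_all add: f f(2)[unfolded One_nat_def])
  have "bij_betw (\<lambda>(i, d). p ^ i * d) ({..k} \<times> {d. d dvd m}) {d. d dvd p ^ k * m}"
    unfolding bij_betw_def
  proof safe
    show "inj_on (\<lambda>(i, d). p ^ i * d) ({..k} \<times> {d. d dvd m})"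
    proof (rule inj_onI; clarsimp)
      fix i d j e assume *: "d dvd m" "e dvd m" "p ^ i * d = p ^ j * e"
      have nd: "\<not> p dvd d" "\<not> p dvd e" using * p dvd_trans by blast+
      have "d \<noteq> 0" "e \<noteq> 0" using nd by (metis dvd_0_right)+
      then have "multiplicity p (p ^ i * d) = i" "multiplicity p (p ^ j * e) = j"
        using p nd by (auto simp: prime_elem_multiplicity_mult_distrib not_dvd_imp_multiplicity_0)
      with *(3) p show "i = j \<and> d = e" by auto
    qed
    fix i d assume "d dvd m" "i \<le> k"
    then show "p ^ i * d dvd p ^ k * m" by (intro mult_dvd_mono le_imp_power_dvd)
  next
    fix d assume d: "d dvd p ^ k * m"
    obtain a b where ab: "d = a * b" "a dvd p ^ k" "b dvd m" using d by (rule dvd_productE)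
    then obtain i where "i \<le> k" "a = p ^ i" using p by (auto simp: divides_primepow_nat)
    with ab show "d \<in> (\<lambda>(i, d). p ^ i * d) ` ({..k} \<times> {d. d dvd m})" by auto
  qed
  then have "(\<Sum>d | d dvd p ^ k * m. f d) = (\<Sum>(i, d)\<in>{..k} \<times> {d. d dvd m}. f (p ^ i * d))"
    by (subst sum.reindex_bij_betw[symmetric, OF _]) (auto simp: case_prod_unfold)
  also have "\<dots> = (\<Sum>i\<le>k. f p ^ i) * (\<Sum>d | d dvd m. f d)"
    by (simp add: f f_pow sum_product sum.cartesian_product)
  finally show ?thesis .
qed

text \<open>These are the local factors of the divisor sums below. For \<open>x = -1\<close> they
  alternate between 1 and 0, so even exponents, and hence squares, get the better bound.\<close>

lemma sum_powers_sign:
  fixes x :: int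
  assumes "x \<in> {-1, 0, 1}"
  shows "(\<Sum>i\<le>k. x ^ i) \<ge> 0" and "even k \<Longrightarrow> (\<Sum>i\<le>k. x ^ i) \<ge> 1"
proof -
  have "(\<Sum>i\<le>k. (-1) ^ i :: int) = (if even k then 1 else 0)" by (induction k) auto
  moreover have "(\<Sum>i\<le>k. 0 ^ i :: int) = 1" by (induction k) auto
  ultimately show "(\<Sum>i\<le>k. x ^ i) \<ge> 0" and "even k \<Longrightarrow> (\<Sum>i\<le>k. x ^ i) \<ge> 1"
    using assms by auto
qed

text \<open>Splitting off the full power of one prime suits multiplicative functions, since the two
  factors in the step are coprime.\<close>

lemma nat_prime_power_induct [case_names zero one step]:
  fixes n :: nat
  assumes "P 0" "P 1" "\<And>p k m. prime p \<Longrightarrow> \<not> p dvd m \<Longrightarrow> m > 0 \<Longrightarrow> P m \<Longrightarrow> P (p ^ k * m)"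
  shows "P n"
proof (induction n rule: less_induct)
  case (less n)
  show ?case
  proof (cases "n \<le> 1")
    case True
    then have "n = 0 \<or> n = 1" by linarith
    then show ?thesis using assms by auto
  next
    case False
    then obtain p where p: "prime p" "p dvd n" using prime_factor_nat[of n] by auto
    have "n \<noteq> 0" "\<not> is_unit p" using False p not_prime_unit by auto
    then obtain m where m: "n = p ^ multiplicity p n * m" "\<not> p dvd m"
      by (rule multiplicity_decompose')
    moreover have "multiplicity p n > 0" using p False by (simp add: prime_multiplicity_gt_zero_iff)
    ultimately obtain k where k: "n = p ^ k * m" "k > 0" by blast
    have "m > 0" using k False by (intro Nat.gr0I) auto
    moreover have "p ^ k > 1" using p prime_gt_1_nat k by (intro one_less_power) auto
    ultimately have "m < p ^ k * m" by simp
    then have "m < n" unfolding k(1) .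
    then show ?thesis by (subst k(1)) (intro assms(3) p(1) m(2) \<open>m > 0\<close> less)
  qed
qed

section \<open>Exponential sums modulo \<open>q\<close>\<close>

lemma periodic_cong:
  fixes P :: "int \<Rightarrow> 'a"
  assumes per: "\<And>a. P (a + m) = P a" and "[a = b] (mod m)"
  shows "P a = P b"
proof -
  obtain k where k: "b = a + m * k"
    using assms(2) by (auto simp: cong_iff_lin)
  have "P (a + m * k) = P a" for a k
  proof (induction k rule: int_induct[where k = 0])
    case (step1 i)
    then show ?case using per[of "a + m * i"] by (simp add: algebra_simps)
  next
    case (step2 i)
    then show ?case using per[of "a + m * (i - 1)"] by (simp add: algebra_simps)
  qed auto
  then show ?thesis by (simp add: k)
qed

lemma sum_residues_mult:
  fixes F :: "int \<Rightarrow> 'a::comm_monoid_add"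
  assumes m: "m > 0" and per: "\<And>a b. [a = b] (mod m) \<Longrightarrow> F a = F b" and u: "coprime u m"
  shows "(\<Sum>t\<in>{0..<m}. F (u * t)) = (\<Sum>t\<in>{0..<m}. F t)"
proof -
  obtain v where v: "[u * v = 1] (mod m)" using u cong_solve_coprime_int by blast
  have *: "u * (v * t mod m) mod m = t" "v * (u * t mod m) mod m = t" if "t \<in> {0..<m}" for t
  proof -
    have "[u * v * t = 1 * t] (mod m)" using v by (rule cong_scalar_right)
    then have "u * (v * t) mod m = t" "v * (u * t) mod m = t"
      using that by (auto simp: cong_def mult_ac)
    then show "u * (v * t mod m) mod m = t" "v * (u * t mod m) mod m = t"
      by (simp_all add: mod_simps)
  qed
  show ?thesis
    by (rule sum.reindex_bij_witness[where i = "\<lambda>t. v * t mod m" and j = "\<lambda>t. u * t mod m"])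
      (use * m in \<open>auto intro!: per simp: cong_def\<close>)
qed

definition exp_frac :: "nat \<Rightarrow> int \<Rightarrow> complex" where
  "exp_frac q a = cis (2 * pi * of_int a / of_nat q)"

lemma exp_frac_0 [simp]: "exp_frac q 0 = 1"
  by (simp add: exp_frac_def)

lemma exp_frac_add: "exp_frac q (a + b) = exp_frac q a * exp_frac q b"
  by (simp add: exp_frac_def cis_mult distrib_left add_divide_distrib)

lemma exp_frac_minus: "exp_frac q (- a) = cnj (exp_frac q a)"
  by (simp add: exp_frac_def cis_cnj)

lemma norm_exp_frac [simp]: "norm (exp_frac q a) = 1"
  by (simp add: exp_frac_def)

lemma exp_frac_mult_nat: "exp_frac q (int n * a) = exp_frac q a ^ n"
  by (induction n) (simp_all add: exp_frac_add distrib_right)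

lemma exp_frac_eq_1_iff:
  assumes "q > 0"
  shows "exp_frac q a = 1 \<longleftrightarrow> int q dvd a"
proof
  assume "exp_frac q a = 1"
  then have "cos (2 * pi * of_int a / of_nat q) = 1"
    by (simp add: exp_frac_def complex_eq_iff)
  then obtain n :: int where "2 * pi * of_int a / of_nat q = of_int n * 2 * pi"
    using cos_one_2pi_int by blast
  then have "real_of_int a = real_of_int (n * int q)" using assms by (simp add: field_simps)
  then have "a = n * int q" by (rule of_int_eq_iff[THEN iffD1])
  then show "int q dvd a" by simp
next
  assume "int q dvd a"
  then obtain n where "a = int q * n" by blast
  then have "2 * pi * of_int a / of_nat q = 2 * pi * of_int n" using assms by simp
  then show "exp_frac q a = 1" by (simp only: exp_frac_def cis_multiple_2pi Ints_of_int)
qed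

lemma exp_frac_cong:
  assumes "q > 0" "[a = b] (mod int q)"
  shows "exp_frac q a = exp_frac q b"
  by (rule periodic_cong[OF _ assms(2)])
    (use assms exp_frac_eq_1_iff[of q "int q"] in \<open>simp add: exp_frac_add\<close>)

lemma sum_exp_frac:
  assumes "q > 0"
  shows "(\<Sum>a\<in>{0..<int q}. exp_frac q (a * c)) = (if int q dvd c then of_nat q else 0)"
proof -
  have "(\<Sum>a\<in>{0..<int q}. exp_frac q (a * c)) = (\<Sum>k<q. exp_frac q c ^ k)"
    using sum.atLeast_int_lessThan_int_shift[of "\<lambda>a. exp_frac q (a * c)" 0 q]
    by (simp add: exp_frac_mult_nat atLeast0LessThan)
  also have "\<dots> = (if int q dvd c then of_nat q else 0)"
    using exp_frac_eq_1_iff[OF assms, of c] exp_frac_eq_1_iff[OF assms, of "int q * c"]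
    by (auto simp: sum_gp_strict exp_frac_mult_nat)
  finally show ?thesis .
qed

text \<open>
  The functions \<open>t \<mapsto> f (\<zeta>\<^sup>t)\<close> with \<open>\<zeta>\<close> a primitive \<open>q\<close>-th root of unity and \<open>f\<close> a Laurent polynomial with
  integer coefficients. Evaluation at \<open>t\<close> coprime to \<open>q\<close> plays the role of Galois conjugation.
\<close>

inductive exp_sum :: "nat \<Rightarrow> (int \<Rightarrow> complex) \<Rightarrow> bool" for q where
  zero: "exp_sum q (\<lambda>_. 0)"
| plus: "exp_sum q f \<Longrightarrow> exp_sum q (\<lambda>t. f t + exp_frac q (k * t))"
| minus: "exp_sum q f \<Longrightarrow> exp_sum q (\<lambda>t. f t - exp_frac q (k * t))"

lemma exp_sum_exp_frac: "exp_sum q (\<lambda>t. exp_frac q (k * t))"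
  using exp_sum.plus[OF exp_sum.zero, of q k] by simp

lemma exp_sum_1: "exp_sum q (\<lambda>_. 1)"
  using exp_sum_exp_frac[of q 0] by simp

lemma exp_sum_add:
  assumes "exp_sum q f" "exp_sum q g"
  shows "exp_sum q (\<lambda>t. f t + g t)"
  using assms(2)
proof induction
  case (plus g k)
  then show ?case using exp_sum.plus[of q "\<lambda>t. f t + g t" k] by (simp add: add.assoc)
next
  case (minus g k)
  then show ?case using exp_sum.minus[of q "\<lambda>t. f t + g t" k] by (simp add: add_diff_eq)
qed (use assms in simp)

lemma exp_sum_diff:
  assumes "exp_sum q f" "exp_sum q g"
  shows "exp_sum q (\<lambda>t. f t - g t)"
  using assms(2)
proof induction
  case (plus g k)
  then show ?case using exp_sum.minus[of q "\<lambda>t. f t - g t" k] by (simp add: diff_diff_add)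
next
  case (minus g k)
  then show ?case using exp_sum.plus[of q "\<lambda>t. f t - g t" k] by (simp add: algebra_simps)
qed (use assms in simp)

lemma exp_sum_scale:
  assumes "exp_sum q f"
  shows "exp_sum q (\<lambda>t. f (u * t))"
  using assms
proof induction
  case (plus f k)
  then show ?case using exp_sum.plus[of q "\<lambda>t. f (u * t)" "k * u"] by (simp add: mult.assoc)
next
  case (minus f k)
  then show ?case using exp_sum.minus[of q "\<lambda>t. f (u * t)" "k * u"] by (simp add: mult.assoc)
qed (rule exp_sum.zero)

lemma exp_sum_mult:
  assumes "exp_sum q f" "exp_sum q g"
  shows "exp_sum q (\<lambda>t. f t * g t)"
proof -
  have shift: "exp_sum q (\<lambda>t. f t * exp_frac q (k * t))" for k
    using assms(1)
  proof induction
    case (plus f l)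
    then show ?case using exp_sum.plus[of q "\<lambda>t. f t * exp_frac q (k * t)" "l + k"]
      by (simp add: distrib_right exp_frac_add)
  next
    case (minus f l)
    then show ?case using exp_sum.minus[of q "\<lambda>t. f t * exp_frac q (k * t)" "l + k"]
      by (simp add: distrib_right left_diff_distrib exp_frac_add)
  qed (simp add: exp_sum.zero)
  show ?thesis using assms(2)
  proof induction
    case (plus g k)
    then show ?case using exp_sum_add[OF _ shift[of k]] by (simp add: distrib_left)
  next
    case (minus g k)
    then show ?case using exp_sum_diff[OF _ shift[of k]] by (simp add: right_diff_distrib)
  qed (simp add: exp_sum.zero)
qed

lemma exp_sum_power: "exp_sum q f \<Longrightarrow> exp_sum q (\<lambda>t. f t ^ n)"
  by (induction n) (simp_all add: exp_sum_1 exp_sum_mult)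

lemma exp_sum_sum:
  assumes "finite A" "\<And>a. a \<in> A \<Longrightarrow> exp_sum q (f a)"
  shows "exp_sum q (\<lambda>t. \<Sum>a\<in>A. f a t)"
  using assms by (induction A) (simp_all add: exp_sum.zero exp_sum_add)

lemma exp_sum_prod:
  assumes "finite A" "\<And>a. a \<in> A \<Longrightarrow> exp_sum q (f a)"
  shows "exp_sum q (\<lambda>t. \<Prod>a\<in>A. f a t)"
  using assms by (induction A) (simp_all add: exp_sum_1 exp_sum_mult)

section \<open>Integrality criteria for rational numbers\<close>

lemma quotient_lowest_terms:
  fixes a :: int and N :: nat
  assumes "N > 0"
  obtains p d :: int where "coprime p d" "d > 0" "of_int a / of_nat N = (of_int p / of_int d :: 'a :: field_char_0)"
proof -
  define g where "g = gcd a (int N)"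
  have g: "g > 0" "a = (a div g) * g" "int N = (int N div g) * g" using assms by (auto simp: g_def)
  have cop: "coprime (a div g) (int N div g)"
    unfolding g_def using assms by (intro div_gcd_coprime) auto
  have d: "int N div g > 0" using g assms
    by (metis of_nat_0_less_iff zero_less_mult_pos2)
  have "of_int a / of_nat N = (of_int ((a div g) * g) / of_int ((int N div g) * g) :: 'a)"
    using g(2,3) by (metis of_int_of_nat_eq)
  also have "\<dots> = of_int (a div g) / of_int (int N div g)" using g(1) by simp
  finally show ?thesis using that cop d by blast
qed

text \<open>Stands in for the fact that a rational algebraic integer is an integer: for
  \<open>z = p / d\<close> in lowest terms every power of \<open>d\<close> must divide
  \<open>N\<close>.\<close>

lemma Ints_if_power_denominators_bounded:
  fixes z :: complex and N :: nat
  assumes N: "N > 0" and "\<And>k. of_nat N * z ^ k \<in> \<int>"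
  shows "z \<in> \<int>"
proof -
  from assms(2)[of 1] obtain a :: int where "of_nat N * z = of_int a" by (auto elim: Ints_cases)
  then have z: "z = of_int a / of_nat N" using N by (simp add: field_simps)
  obtain p d :: int where pd: "coprime p d" "d > 0" "of_int a / of_nat N = (of_int p / of_int d :: complex)"
    using N by (rule quotient_lowest_terms)
  \<comment> \<open>The exponent \<open>N\<close> is large enough: \<open>d \<ge> 2\<close> would
    give \<open>d ^ N \<ge> 2 ^ N > N\<close>, although \<open>d ^ N\<close> divides
    \<open>N\<close>.\<close>
  from assms(2)[of N] obtain b :: int where "of_nat N * z ^ N = of_int b" by (auto elim: Ints_cases)
  then have "complex_of_int (int N * p ^ N) = of_int (b * d ^ N)"
    using pd(2) by (simp add: z pd(3) field_simps)
  then have "int N * p ^ N = b * d ^ N" by (rule of_int_eq_iff[THEN iffD1])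
  then have "d ^ N dvd int N * p ^ N" by simp
  moreover have "coprime (d ^ N) (p ^ N)" using pd(1) by (simp add: coprime_commute)
  ultimately have "d ^ N dvd int N" by (simp add: coprime_dvd_mult_left_iff)
  then have le: "d ^ N \<le> int N" using N by (intro zdvd_imp_le) auto
  have "d = 1"
  proof (rule ccontr)
    assume "d \<noteq> 1"
    then have "2 ^ N \<le> d ^ N" using pd(2) by (intro power_mono) auto
    moreover have "int N < 2 ^ N" by (metis less_exp of_nat_less_iff of_nat_numeral of_nat_power)
    ultimately show False using le by simp
  qed
  then show ?thesis by (simp add: z pd(3))
qed

text \<open>In lowest terms the squared denominator is coprime to the squared numerator, so it must
  divide the squarefree \<open>m\<close>.\<close>

lemma Ints_if_square_times_squarefree:
  fixes a :: int and N m :: nat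
  assumes N: "N > 0" and m: "\<And>b::int. b * b dvd int m \<Longrightarrow> b > 0 \<Longrightarrow> b = 1"
    and int: "(of_int a / of_nat N) ^ 2 * of_nat m \<in> (\<int> :: real set)"
  shows "of_int a / of_nat N \<in> (\<int> :: real set)"
proof -
  obtain p d :: int where pd: "coprime p d" "d > 0" "of_int a / of_nat N = (of_int p / of_int d :: real)"
    using N by (rule quotient_lowest_terms)
  obtain b :: int where "(of_int p / of_int d) ^ 2 * of_nat m = real_of_int b"
    using int unfolding pd(3) by (auto elim: Ints_cases)
  then have "real_of_int (p ^ 2 * int m) = of_int (b * d ^ 2)"
    using pd(2) by (simp add: field_simps)
  then have "p ^ 2 * int m = b * d ^ 2" by (rule of_int_eq_iff[THEN iffD1])
  then have "d ^ 2 dvd p ^ 2 * int m" by simp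
  moreover have "coprime (d ^ 2) (p ^ 2)" using pd(1) by (simp add: coprime_commute)
  ultimately have "d * d dvd int m" by (simp add: coprime_dvd_mult_right_iff power2_eq_square)
  then have "d = 1" using m pd(2) by blast
  then show ?thesis by (simp add: pd(3))
qed

text \<open>This is \<open>sin ((2 * h + 1) * pi * x / q) / sin (pi * x / q)\<close> wherever the
  denominator is nonzero. The symmetric range makes it real and even in \<open>x\<close>, and the
  odd multiplier keeps all exponents integral.\<close>

definition dirichlet_kernel :: "nat \<Rightarrow> nat \<Rightarrow> int \<Rightarrow> complex" where
  "dirichlet_kernel q h x = (\<Sum>j\<in>{- int h..int h}. exp_frac q (j * x))"

text \<open>The product telescopes. A factor of modulus 1 is split off on the right, so that the
  norm of a kernel is a quotient of norms of the form
  \<open>norm (1 - exp_frac q y)\<close>.\<close>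

lemma dirichlet_kernel_mult:
  "(1 - exp_frac q x) * dirichlet_kernel q h x
     = exp_frac q (- int h * x) * (1 - exp_frac q ((2 * int h + 1) * x))"
proof -
  have "(1 - exp_frac q x) * dirichlet_kernel q h x = exp_frac q (- int h * x) - exp_frac q ((int h + 1) * x)"
  proof (induction h)
    case (Suc h)
    have "{- int (Suc h)..int (Suc h)} = {- int (Suc h), int (Suc h)} \<union> {- int h..int h}" by auto
    then have "dirichlet_kernel q (Suc h) x = exp_frac q (- int (Suc h) * x) + exp_frac q (int (Suc h) * x)
        + dirichlet_kernel q h x"
      by (simp add: dirichlet_kernel_def)
    moreover have "exp_frac q x * exp_frac q (- int (Suc h) * x) = exp_frac q (- int h * x)"
      "exp_frac q x * exp_frac q (int (Suc h) * x) = exp_frac q ((int (Suc h) + 1) * x)"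
      by (simp_all add: algebra_simps flip: exp_frac_add)
    ultimately show ?case using Suc by (simp add: algebra_simps)
  qed (simp add: dirichlet_kernel_def)
  also have "\<dots> = exp_frac q (- int h * x) * (1 - exp_frac q ((2 * int h + 1) * x))"
    by (simp add: right_diff_distrib algebra_simps flip: exp_frac_add)
  finally show ?thesis .
qed

lemma dirichlet_kernel_minus: "dirichlet_kernel q h (- x) = dirichlet_kernel q h x"
  unfolding dirichlet_kernel_def
  by (rule sum.reindex_bij_witness[where i = uminus and j = uminus]) auto

lemma cnj_dirichlet_kernel: "cnj (dirichlet_kernel q h x) = dirichlet_kernel q h x"
proof -
  have "cnj (dirichlet_kernel q h x) = dirichlet_kernel q h (- x)"
    by (simp add: dirichlet_kernel_def exp_frac_minus)
  then show ?thesis by (simp add: dirichlet_kernel_minus)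
qed

lemma dirichlet_kernel_cong:
  assumes "q > 0" "[x = y] (mod int q)"
  shows "dirichlet_kernel q h x = dirichlet_kernel q h y"
  unfolding dirichlet_kernel_def
  by (intro sum.cong refl exp_frac_cong assms cong_scalar_left)

lemma exp_sum_dirichlet_kernel: "exp_sum q (\<lambda>t. dirichlet_kernel q h (t * a))"
  unfolding dirichlet_kernel_def
  by (intro exp_sum_sum) (use exp_sum_exp_frac[of q "_ * a"] in \<open>auto simp: mult_ac\<close>)

section \<open>The Gauss sum\<close>

text \<open>\<open>X\<close> is \<chi> with its values read as integers. Primitivity appears as
  nontriviality of \<open>X\<close> on the units congruent to 1 modulo each proper divisor
  \<open>d\<close>; for \<open>d = 1\<close> it says that \<open>X\<close> is not principal.\<close>

locale even_primitive_real_character =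
  fixes q :: nat and X :: "int \<Rightarrow> int"
  assumes q_gt_1: "q > 1"
    and X_periodic: "X (a + int q) = X a"
    and X_mult: "X (a * b) = X a * X b"
    and X_eq_0_iff: "X a = 0 \<longleftrightarrow> \<not> coprime a (int q)"
    and X_values: "X a \<in> {-1, 0, 1}"
    and X_minus_1: "X (-1) = 1"
    and primitive: "d dvd q \<Longrightarrow> d < q \<Longrightarrow>
      \<exists>u. coprime u (int q) \<and> [u = 1] (mod int d) \<and> X u \<noteq> 1"
begin

abbreviation e :: "int \<Rightarrow> complex" where "e \<equiv> exp_frac q"

lemma q_pos: "q > 0" using q_gt_1 by simp

lemma X_cong: "[a = b] (mod int q) \<Longrightarrow> X a = X b"
  by (rule periodic_cong[of X "int q"]) (simp_all add: X_periodic)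

lemma e_cong: "[a = b] (mod int q) \<Longrightarrow> e a = e b"
  by (rule exp_frac_cong[OF q_pos])

lemma X_1 [simp]: "X 1 = 1"
  using X_mult[of 1 1] X_eq_0_iff[of 1] by auto

lemma X_0 [simp]: "X 0 = 0"
  using X_eq_0_iff[of 0] q_gt_1 by auto

lemma X_minus [simp]: "X (- a) = X a"
  using X_mult[of "-1" a] X_minus_1 by simp

lemma X_power: "X (a ^ n) = X a ^ n"
  by (induction n) (auto simp: X_mult)

lemma X_sq: "coprime a (int q) \<Longrightarrow> X a * X a = 1"
  using X_values[of a] X_eq_0_iff[of a] by auto

definition gauss_sum :: complex where
  "gauss_sum = (\<Sum>t\<in>{0..<int q}. of_int (X t) * e t)"

text \<open>For \<open>m\<close> coprime to \<open>q\<close> this is a substitution of the summation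
  variable. For other \<open>m\<close> both sides vanish: primitivity supplies a unit
  \<open>u\<close> with \<open>X u \<noteq> 1\<close> that fixes \<open>m\<close> modulo
  \<open>q\<close>, whence \<open>X u * G m = G m\<close>.\<close>

lemma gauss_sum_twist: "(\<Sum>t\<in>{0..<int q}. of_int (X t) * e (m * t)) = of_int (X m) * gauss_sum"
proof -
  define G where "G m = (\<Sum>t\<in>{0..<int q}. of_int (X t) * e (m * t))" for m
  have shift: "of_int (X u) * G (m * u) = G m" if "coprime u (int q)" for u m
  proof -
    have "G m = (\<Sum>t\<in>{0..<int q}. of_int (X (u * t)) * e (m * (u * t)))"
      unfolding G_def
    proof (rule sum_residues_mult[symmetric])
      fix a b assume ab: "[a = b] (mod int q)"
      then show "of_int (X a) * e (m * a) = of_int (X b) * e (m * b)"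
        using X_cong[OF ab] e_cong[OF cong_scalar_left[OF ab, of m]] by simp
    qed (use that q_pos in auto)
    also have "\<dots> = of_int (X u) * G (m * u)"
      by (simp add: G_def X_mult sum_distrib_left mult_ac)
    finally show ?thesis by simp
  qed
  have "G m = of_int (X m) * G 1"
  proof (cases "coprime m (int q)")
    case True
    have "of_int (X m * X m) * G m = of_int (X m) * G 1"
      using shift[OF True, of 1] by simp
    then show ?thesis using X_sq[OF True] by simp
  next
    case False
    define g where "g = nat (gcd (int q) m)"
    have g: "int g dvd m" "g dvd q" "g > 1"
    proof -
      have "int g = gcd (int q) m" by (simp add: g_def)
      moreover have "gcd (int q) m \<noteq> 1" using False by (simp add: coprime_iff_gcd_eq_1 gcd.commute)
      moreover have "gcd (int q) m > 0" using q_pos by simp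
      ultimately show "g > 1" by linarith
      show "int g dvd m" "g dvd q"
        using \<open>int g = gcd (int q) m\<close> by (simp_all flip: int_dvd_int_iff)
    qed
    \<comment> \<open>Here \<open>d\<close> is \<open>q\<close> divided by the gcd, so
      \<open>u\<close> congruent to 1 modulo \<open>d\<close> makes \<open>q = d * g\<close> divide
      \<open>(u - 1) * m\<close>.\<close>
    then obtain d where d: "q = d * g" by (auto simp: dvd_def mult.commute)
    have "d dvd q" "d < q" using g(3) q_pos by (auto simp: d)
    then obtain u where u: "coprime u (int q)" "[u = 1] (mod int d)" "X u \<noteq> 1"
      using primitive by blast
    have "int q dvd (u - 1) * m"
      unfolding d of_nat_mult using g(1) u(2) by (intro mult_dvd_mono) (auto simp: cong_iff_dvd_diff)
    then have "[m * u = m] (mod int q)" by (simp add: cong_iff_dvd_diff algebra_simps)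
    then have "G (m * u) = G m"
      unfolding G_def by (intro sum.cong refl arg_cong2[of _ _ _ _ "(*)"] e_cong cong_scalar_right)
    then have "of_int (X u) * G m = G m" using shift[OF u(1), of m] by simp
    then have "G m = 0" using u(3) by auto
    then show ?thesis using False X_eq_0_iff by simp
  qed
  then show ?thesis by (simp add: G_def gauss_sum_def)
qed

text \<open>Conjugation is the twist by -1, so evenness of \<open>X\<close> makes the Gauss sum
  real; this fixes the sign of its square.\<close>

lemma gauss_sum_cnj: "cnj gauss_sum = gauss_sum"
  using gauss_sum_twist[of "-1"] by (simp add: gauss_sum_def exp_frac_minus X_minus_1)

text \<open>Applying the twist formula under the conjugate sum gives a double sum, in which
  orthogonality of the exponentials leaves only \<open>b = 1\<close>.\<close>

lemma gauss_sum_square: "gauss_sum ^ 2 = of_nat q"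
proof -
  have *: "cnj gauss_sum = (\<Sum>t\<in>{0..<int q}. of_int (X t) * e (- t))"
    by (simp add: gauss_sum_def exp_frac_minus)
  have "gauss_sum * gauss_sum = (\<Sum>t\<in>{0..<int q}. of_int (X t) * e (- t)) * gauss_sum"
    by (subst *[symmetric]) (simp add: gauss_sum_cnj)
  also have "\<dots> = (\<Sum>t\<in>{0..<int q}. e (- t) * (of_int (X t) * gauss_sum))"
    by (subst sum_distrib_right) (simp add: mult_ac)
  also have "\<dots> = (\<Sum>t\<in>{0..<int q}. \<Sum>b\<in>{0..<int q}. of_int (X b) * e (t * (b - 1)))"
    by (simp flip: gauss_sum_twist exp_frac_add add: sum_distrib_left mult_ac algebra_simps)
  also have "\<dots> = (\<Sum>b\<in>{0..<int q}. of_int (X b) * (\<Sum>t\<in>{0..<int q}. e (t * (b - 1))))"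
    by (subst sum.swap) (simp add: sum_distrib_left)
  also have "\<dots> = (\<Sum>b\<in>{0..<int q}. if b = 1 then of_nat q else 0)"
  proof (rule sum.cong[OF refl])
    fix b assume b: "b \<in> {0..<int q}"
    have "int q dvd b - 1 \<longleftrightarrow> b = 1"
    proof
      assume "int q dvd b - 1"
      then have "b mod int q = 1 mod int q" by (simp add: mod_eq_dvd_iff)
      then show "b = 1" using b q_gt_1 by simp
    qed simp
    then show "of_int (X b) * (\<Sum>t\<in>{0..<int q}. e (t * (b - 1))) = (if b = 1 then of_nat q else 0)"
      using q_pos by (simp add: sum_exp_frac)
  qed
  also have "\<dots> = of_nat q" using q_gt_1 by simp
  finally show ?thesis by (simp add: power2_eq_square)
qed

section \<open>The value \<open>L(1, \<chi>)\<close>\<close>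

definition divisor_sum :: "nat \<Rightarrow> int" where "divisor_sum n = (\<Sum>d | d dvd n. X (int d))"

lemma divisor_sum_prime_power_mult:
  assumes "prime p" "\<not> p dvd m" "m > 0"
  shows "divisor_sum (p ^ k * m) = (\<Sum>i\<le>k. X (int p) ^ i) * divisor_sum m"
  unfolding divisor_sum_def using assms by (intro sum_divisors_prime_power_mult) (auto simp: X_mult)

lemma divisor_sum_1 [simp]: "divisor_sum (Suc 0) = 1" by (simp add: divisor_sum_def)

lemma divisor_sum_nonneg: "divisor_sum n \<ge> 0"
proof (cases "n = 0")
  \<comment> \<open>All naturals divide 0, so for \<open>n = 0\<close> the sum ranges over an
    infinite set and is 0 by convention; that case is closed at the end.\<close>
  case False
  have "n > 0 \<longrightarrow> divisor_sum n \<ge> 0"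
  proof (induction n rule: nat_prime_power_induct)
    case (step p k m)
    then show ?case using sum_powers_sign(1)[OF X_values] by (auto simp: divisor_sum_prime_power_mult)
  qed auto
  then show ?thesis using False by simp
qed (simp add: divisor_sum_def)

text \<open>Primes occur in a square with even exponents, so each local factor is at least
  1.\<close>

lemma divisor_sum_square_pos: "n > 0 \<Longrightarrow> divisor_sum (n ^ 2) \<ge> 1"
proof (induction n rule: nat_prime_power_induct)
  case (step p k m)
  have "divisor_sum ((p ^ k * m)\<^sup>2) = divisor_sum (p ^ (2 * k) * m\<^sup>2)"
    by (simp add: power_mult_distrib power_mult[symmetric] mult.commute)
  also have "\<dots> = (\<Sum>i\<le>2 * k. X (int p) ^ i) * divisor_sum (m\<^sup>2)"
    by (rule divisor_sum_prime_power_mult) (use step prime_dvd_power_nat in auto)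
  finally have eq: "divisor_sum ((p ^ k * m)\<^sup>2) = (\<Sum>i\<le>2 * k. X (int p) ^ i) * divisor_sum (m\<^sup>2)" .
  have "1 * 1 \<le> (\<Sum>i\<le>2 * k. X (int p) ^ i) * divisor_sum (m\<^sup>2)"
    using step sum_powers_sign[of "X (int p)" "2 * k", OF X_values] by (intro mult_mono) auto
  then show ?case by (simp add: eq)
qed (auto simp: numeral_2_eq_2)

section \<open>Convergence and the logarithmic formula\<close>

lemma norm_gauss_sum_pos: "norm gauss_sum > 0"
  using gauss_sum_square q_pos by auto

lemma e_ne_1:
  assumes "X a \<noteq> 0"
  shows "e a \<noteq> 1"
proof
  assume "e a = 1"
  then have "int q dvd a" by (simp add: exp_frac_eq_1_iff q_pos)
  moreover have "coprime a (int q)" using assms X_eq_0_iff by simp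
  ultimately have "is_unit (int q)" using coprime_common_divisor dvd_refl by metis
  then show False using q_gt_1 by simp
qed

text \<open>Multiplication by the Gauss sum turns each value of \<open>X\<close> into a combination
  of exponentials. The partial sums become geometric sums with ratios \<open>e a \<noteq> 1\<close>,
  each of norm at most \<open>2 / norm (1 - e a)\<close>.\<close>

lemma X_partial_sums_bounded: "\<exists>C. \<forall>n. \<bar>\<Sum>k<n. real_of_int (X (int (Suc k)))\<bar> \<le> C"
proof -
  define B where "B a = (if X a = 0 then 0 else 2 / norm (1 - e a))" for a
  define C where "C = (\<Sum>a\<in>{0..<int q}. B a) / norm gauss_sum"
  have "\<bar>\<Sum>k<n. real_of_int (X (int (Suc k)))\<bar> \<le> C" for n
  proof -
    have "complex_of_int (\<Sum>k<n. X (int (Suc k))) * gauss_sum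
        = (\<Sum>k<n. \<Sum>a\<in>{0..<int q}. of_int (X a) * e (int (Suc k) * a))"
      by (simp only: gauss_sum_twist of_int_sum sum_distrib_right)
    also have "\<dots> = (\<Sum>a\<in>{0..<int q}. of_int (X a) * (\<Sum>k<n. e a ^ Suc k))"
      by (subst sum.swap) (simp only: exp_frac_mult_nat sum_distrib_left)
    also have "norm \<dots> \<le> (\<Sum>a\<in>{0..<int q}. B a)"
    proof (rule sum_norm_le)
      fix a
      show "norm (of_int (X a) * (\<Sum>k<n. e a ^ Suc k)) \<le> B a"
      proof (cases "X a = 0")
        case False
        then have ne: "e a \<noteq> 1" by (rule e_ne_1)
        have "(\<Sum>k<n. e a ^ Suc k) = e a * ((1 - e a ^ n) / (1 - e a))"
          using ne by (simp add: sum_gp_strict flip: sum_distrib_left)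
        then have "norm (\<Sum>k<n. e a ^ Suc k) = norm (1 - e a ^ n) / norm (1 - e a)"
          by (simp add: norm_mult norm_divide)
        also have "\<dots> \<le> 2 / norm (1 - e a)"
          using norm_triangle_ineq4[of 1 "e a ^ n"] by (intro divide_right_mono) (auto simp: norm_power)
        finally have "norm (\<Sum>k<n. e a ^ Suc k) \<le> 2 / norm (1 - e a)" .
        moreover have "\<bar>real_of_int (X a)\<bar> = 1" using X_values[of a] False by auto
        ultimately show ?thesis using False by (simp add: norm_mult B_def)
      qed (simp add: B_def)
    qed
    finally have "\<bar>real_of_int (\<Sum>k<n. X (int (Suc k)))\<bar> * norm gauss_sum \<le> (\<Sum>a\<in>{0..<int q}. B a)"
      by (simp only: norm_mult norm_of_int)
    then show ?thesis using norm_gauss_sum_pos by (simp add: C_def field_simps)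
  qed
  then show ?thesis by blast
qed

definition L :: real where "L = (\<Sum>k. of_int (X (int (Suc k))) * (1 / Suc k))"

lemma L_sums: "(\<lambda>k. real_of_int (X (int (Suc k))) * (1 / Suc k)) sums L"
proof -
  obtain C where C: "\<And>n. \<bar>\<Sum>k<n. real_of_int (X (int (Suc k)))\<bar> \<le> C"
    using X_partial_sums_bounded by blast
  have "summable (\<lambda>k. real_of_int (X (int (Suc k))) * (1 / Suc k))"
    by (intro summable_bounded_partial_sums(1)[OF C] lim_inverse_n' LIMSEQ_Suc frac_le)
      (auto intro!: LIMSEQ_Suc[OF lim_inverse_n', simplified] simp: field_simps)
  then show ?thesis unfolding L_def by (rule summable_sums)
qed

text \<open>For \<open>x < 1\<close> the logarithms expand into convergent series, and
  \<open>gauss_sum_twist\<close> collects the sum over \<open>a\<close>. Taking real parts replaces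
  \<open>Ln\<close> by \<open>ln\<close> of the norm, which is free of branches.\<close>

lemma L_power_series:
  assumes x: "0 \<le> x" "x < 1"
  shows "Re gauss_sum * (\<Sum>k. of_int (X (int (Suc k))) * (x ^ Suc k / Suc k))
    = - (\<Sum>a\<in>{0..<int q}. of_int (X a) * ln (norm (1 - of_real x * e a)))"
proof -
  have "(\<lambda>k. \<Sum>a\<in>{0..<int q}. of_int (X a) * - ((of_real x * e a) ^ Suc k / of_nat (Suc k)))
      sums (\<Sum>a\<in>{0..<int q}. of_int (X a) * Ln (1 - of_real x * e a))"
  proof (intro sums_sum sums_mult)
    fix a
    have "norm (- (of_real x * e a)) < 1" using x by (simp add: norm_mult)
    from Ln_series'[OF this]
    have "(\<lambda>n. - ((of_real x * e a) ^ n) / of_nat n) sums Ln (1 - of_real x * e a)" by simp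
    \<comment> \<open>The term at index 0 is a division by zero, hence 0. Adding it to the limit
      explicitly lets \<open>sums_Suc_iff\<close> shift the index.\<close>
    then have "(\<lambda>n. - ((of_real x * e a) ^ n) / of_nat n) sums
        (Ln (1 - of_real x * e a) + - ((of_real x * e a) ^ 0) / of_nat 0)" by simp
    then have "(\<lambda>k. - ((of_real x * e a) ^ Suc k) / of_nat (Suc k)) sums Ln (1 - of_real x * e a)"
      by (subst sums_Suc_iff)
    then show "(\<lambda>k. - ((of_real x * e a) ^ Suc k / of_nat (Suc k))) sums Ln (1 - of_real x * e a)"
      by (simp only: minus_divide_left)
  qed
  moreover have "(\<Sum>a\<in>{0..<int q}. of_int (X a) * - ((of_real x * e a) ^ Suc k / of_nat (Suc k)))
      = - (gauss_sum * of_real (of_int (X (int (Suc k))) * (x ^ Suc k / Suc k)))" for k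
  proof -
    have "(\<Sum>a\<in>{0..<int q}. of_int (X a) * - ((of_real x * e a) ^ Suc k / of_nat (Suc k)))
      = - (of_real (x ^ Suc k / Suc k) * (\<Sum>a\<in>{0..<int q}. of_int (X a) * e (int (Suc k) * a)))"
      by (simp only: exp_frac_mult_nat sum_distrib_left sum_negf[symmetric])
        (simp add: power_mult_distrib mult_ac)
    then show ?thesis by (simp only: gauss_sum_twist) simp
  qed
  ultimately have "(\<lambda>k. - (gauss_sum * of_real (of_int (X (int (Suc k))) * (x ^ Suc k / Suc k))))
      sums (\<Sum>a\<in>{0..<int q}. of_int (X a) * Ln (1 - of_real x * e a))" by simp
  then have "(\<lambda>k. Re (- (gauss_sum * of_real (of_int (X (int (Suc k))) * (x ^ Suc k / Suc k)))))
      sums Re (\<Sum>a\<in>{0..<int q}. of_int (X a) * Ln (1 - of_real x * e a))" by (rule sums_Re)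
  moreover have "Re (\<Sum>a\<in>{0..<int q}. of_int (X a) * Ln (1 - of_real x * e a))
      = (\<Sum>a\<in>{0..<int q}. of_int (X a) * ln (norm (1 - of_real x * e a)))"
  proof -
    have "1 - of_real x * e a \<noteq> 0" for a
    proof
      assume "1 - of_real x * e a = 0"
      then have "norm (of_real x * e a) = 1" by simp
      then show False using x by (simp add: norm_mult)
    qed
    then show ?thesis by (simp add: Re_sum Re_Ln)
  qed
  ultimately have "(\<lambda>k. - (Re gauss_sum * (of_int (X (int (Suc k))) * (x ^ Suc k / Suc k))))
      sums (\<Sum>a\<in>{0..<int q}. of_int (X a) * ln (norm (1 - of_real x * e a)))" by simp
  then have "(\<lambda>k. Re gauss_sum * (of_int (X (int (Suc k))) * (x ^ Suc k / Suc k)))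
      sums - (\<Sum>a\<in>{0..<int q}. of_int (X a) * ln (norm (1 - of_real x * e a)))"
    using sums_minus by fastforce
  moreover have "Re gauss_sum \<noteq> 0"
    using norm_gauss_sum_pos gauss_sum_cnj by (auto simp: complex_eq_iff)
  ultimately have "(\<lambda>k. of_int (X (int (Suc k))) * (x ^ Suc k / Suc k))
      sums (- (\<Sum>a\<in>{0..<int q}. of_int (X a) * ln (norm (1 - of_real x * e a))) / Re gauss_sum)"
    by (subst sums_mult_iff[symmetric]) auto
  then show ?thesis using \<open>Re gauss_sum \<noteq> 0\<close> by (simp add: sums_iff)
qed

text \<open>The limit of \<open>L_power_series\<close> as \<open>x\<close> tends to 1 from the left:
  Abel's theorem treats the series, and continuity of \<open>ln\<close> treats the finite sum, as
  \<open>e a \<noteq> 1\<close> whenever \<open>X a \<noteq> 0\<close>.\<close>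

lemma L_log_formula:
  "Re gauss_sum * L = - (\<Sum>a\<in>{0..<int q}. of_int (X a) * ln (norm (1 - e a)))"
proof -
  obtain C where C: "\<And>n. \<bar>\<Sum>k<n. real_of_int (X (int (Suc k)))\<bar> \<le> C"
    using X_partial_sums_bounded by blast
  have lim1: "((\<lambda>x. Re gauss_sum * (\<Sum>k. of_int (X (int (Suc k))) * (x ^ Suc k / Suc k)))
      \<longlongrightarrow> Re gauss_sum * L) (at_left 1)"
    unfolding L_def by (intro tendsto_intros power_series_tendsto_at_left_1[OF C])
  have lim2: "((\<lambda>x. - (\<Sum>a\<in>{0..<int q}. of_int (X a) * ln (norm (1 - of_real x * e a))))
      \<longlongrightarrow> - (\<Sum>a\<in>{0..<int q}. of_int (X a) * ln (norm (1 - e a)))) (at_left 1)"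
  proof (intro tendsto_minus tendsto_sum)
    fix a
    show "((\<lambda>x. of_int (X a) * ln (norm (1 - of_real x * e a)))
      \<longlongrightarrow> of_int (X a) * ln (norm (1 - e a))) (at_left (1::real))"
    proof (cases "X a = 0")
      case False
      then have "e a \<noteq> 1" by (rule e_ne_1)
      moreover have "((\<lambda>x. norm (1 - complex_of_real x * e a)) \<longlongrightarrow> norm (1 - of_real 1 * e a)) (at_left 1)"
        by (intro tendsto_intros)
      ultimately show ?thesis by (intro tendsto_mult tendsto_const tendsto_ln) auto
    qed auto
  qed
  have "eventually (\<lambda>x. x \<in> {0<..<1}) (at_left (1::real))"
    by (rule eventually_at_leftI[of 0]) auto
  then have "\<forall>\<^sub>F x in at_left 1. - (\<Sum>a\<in>{0..<int q}. of_int (X a) * ln (norm (1 - of_real x * e a)))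
      = Re gauss_sum * (\<Sum>k. of_int (X (int (Suc k))) * (x ^ Suc k / Suc k))"
    by eventually_elim (use L_power_series in auto)
  then show ?thesis
    by (intro tendsto_unique[OF _ lim1 Lim_transform_eventually[OF lim2]]) auto
qed

text \<open>Expanding the geometric series and collecting equal exponents turns the Lambert series
  into the power series with coefficients \<open>divisor_sum\<close>, which are nonnegative and at
  least 1 at positive squares.\<close>

lemma lambert_series_lower_bound:
  assumes x: "0 < x" "x < (1::real)"
  defines "f \<equiv> \<lambda>k. real_of_int (X (int (Suc k))) * (x ^ Suc k / (1 - x ^ Suc k))"
  shows "real M * x ^ (M\<^sup>2) \<le> suminf f"
proof -
  define g where "g = (\<lambda>(n, k). real_of_int (X (int (Suc n))) * x ^ (Suc n * Suc k))"
  have pow: "x ^ Suc n < 1" for n using x by (rule power_Suc_less_one)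
  have geo: "((\<lambda>k. x ^ (Suc n * Suc k)) has_sum (x ^ Suc n / (1 - x ^ Suc n))) UNIV" for n
  proof (rule sums_nonneg_imp_has_sum)
    have "(\<lambda>k. x ^ Suc n * (x ^ Suc n) ^ k) sums (x ^ Suc n * (1 / (1 - x ^ Suc n)))"
      using x pow[of n] by (intro sums_mult geometric_sums) auto
    moreover have "x ^ (Suc n * Suc k) = x ^ Suc n * (x ^ Suc n) ^ k" for k
      by (simp only: power_mult power_Suc)
    ultimately show "(\<lambda>k. x ^ (Suc n * Suc k)) sums (x ^ Suc n / (1 - x ^ Suc n))"
      by (simp only: times_divide_eq_right mult_1_right)
  qed (use x in auto)
  have sm_row: "summable (\<lambda>n. x ^ Suc n / (1 - x ^ Suc n))"
  proof (rule summable_comparison_test)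
    show "summable (\<lambda>n. x ^ n * (1 / (1 - x)))"
      using x by (intro summable_mult2 summable_geometric) auto
    have "x ^ Suc n / (1 - x ^ Suc n) \<le> x ^ n / (1 - x)" for n
      using x power_decreasing[of 1 "Suc n" x] by (intro frac_le) (auto intro: mult_left_le_one_le)
    then show "\<exists>N. \<forall>n\<ge>N. norm (x ^ Suc n / (1 - x ^ Suc n)) \<le> x ^ n * (1 / (1 - x))"
      using x pow by (auto simp: abs_of_nonneg less_imp_le)
  qed
  \<comment> \<open>Absolute summability of the double series allows it to be summed both by rows
    and by products.\<close>
  have "(\<lambda>(n, k). x ^ (Suc n * Suc k)) summable_on UNIV \<times> UNIV"
  proof (rule summable_on_SigmaI[where g = "\<lambda>n. x ^ Suc n / (1 - x ^ Suc n)"])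
    show "(\<lambda>n. x ^ Suc n / (1 - x ^ Suc n)) summable_on UNIV"
      using sm_row x pow by (intro summable_nonneg_imp_summable_on) (auto simp: less_imp_le)
  qed (use geo x in auto)
  moreover have g_le: "norm (g p) \<le> (case p of (n, k) \<Rightarrow> x ^ (Suc n * Suc k))" for p
    using X_values[of "int (Suc (fst p))"] x
    by (cases p) (auto simp: g_def abs_mult simp del: power_Suc of_nat_Suc mult_Suc)
  ultimately have "(\<lambda>p. norm (g p)) summable_on UNIV \<times> UNIV"
    by (rule Infinite_Sum.abs_summable_on_comparison_test')
  then have "g summable_on UNIV \<times> UNIV" by (rule abs_summable_summable)
  then obtain S where S: "(g has_sum S) (UNIV \<times> UNIV)" by (auto simp: summable_on_def)
  have "(f has_sum S) UNIV"
  proof (rule has_sum_SigmaD[OF S])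
    fix n
    show "((\<lambda>k. g (n, k)) has_sum f n) UNIV"
      unfolding g_def f_def prod.case by (intro has_sum_cmult_right geo)
  qed
  then have "suminf f = S" by (metis has_sum_imp_sums sums_unique)
  \<comment> \<open>A pair \<open>(n, k)\<close> corresponds to \<open>N = Suc n * Suc k\<close>
    together with its divisor \<open>d = Suc n\<close>.\<close>
  have "((\<lambda>(N, d). real_of_int (X (int d)) * x ^ N) has_sum S) (SIGMA N:{0<..}. {d. d dvd N})"
  proof (subst has_sum_reindex_bij_witness[where S = "UNIV \<times> UNIV" and g = g and s = S, symmetric])
    show "(g has_sum S) (UNIV \<times> UNIV)" by (rule S)
  next
    fix p :: "nat \<times> nat"
    let ?j = "\<lambda>(n, k). (Suc n * Suc k, Suc n)" and ?i = "\<lambda>(N, d). (d - 1, N div d - 1)"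
    show "?i (?j p) = p" "?j p \<in> (SIGMA N:{0<..}. {d. d dvd N})"
      by (cases p; simp del: mult_Suc mult_Suc_right)+
    show "(case ?j p of (N, d) \<Rightarrow> real_of_int (X (int d)) * x ^ N) = g p"
      by (cases p) (simp add: g_def)
    assume "p \<in> (SIGMA N:{0<..}. {d. d dvd N})"
    then show "?j (?i p) = p"
      by (cases p) (auto elim!: dvdE simp del: mult_Suc mult_Suc_right)
  qed auto
  then have R: "((\<lambda>N. real_of_int (divisor_sum N) * x ^ N) has_sum S) {0<..}"
  proof (rule has_sum_SigmaD)
    fix N :: nat assume "N \<in> {0<..}"
    then show "((\<lambda>d. case (N, d) of (N, d) \<Rightarrow> real_of_int (X (int d)) * x ^ N)
        has_sum real_of_int (divisor_sum N) * x ^ N) {d. d dvd N}"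
      by (intro has_sum_finiteI) (auto simp: divisor_sum_def sum_distrib_right)
  qed
  \<comment> \<open>Only the terms at the squares of 1, ..., \<open>M\<close> are kept.\<close>
  have "real M * x ^ (M\<^sup>2) = (\<Sum>m\<in>{1..M}. x ^ (M\<^sup>2))" by simp
  also have "\<dots> \<le> (\<Sum>m\<in>{1..M}. real_of_int (divisor_sum (m\<^sup>2)) * x ^ (m\<^sup>2))"
  proof (rule sum_mono)
    fix m assume m: "m \<in> {1..M}"
    then have "1 * x ^ (M\<^sup>2) \<le> real_of_int (divisor_sum (m\<^sup>2)) * x ^ (m\<^sup>2)"
      using x divisor_sum_square_pos[of m] by (intro mult_mono power_decreasing) (auto intro: power_mono)
    then show "x ^ (M\<^sup>2) \<le> real_of_int (divisor_sum (m\<^sup>2)) * x ^ (m\<^sup>2)" by simp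
  qed
  also have "\<dots> = (\<Sum>N\<in>(\<lambda>m. m\<^sup>2) ` {1..M}. real_of_int (divisor_sum N) * x ^ N)"
    by (subst sum.reindex) (auto simp: inj_on_def)
  also have "\<dots> \<le> S"
    using R by (rule finite_sum_le_has_sum) (use x divisor_sum_nonneg in auto)
  finally show ?thesis using \<open>suminf f = S\<close> by simp
qed

text \<open>\<open>L / (1 - x)\<close> is the Lambert series plus a sum with the decreasing weights
  \<open>b\<close>, which is at most \<open>2 * C\<close> in absolute value. For \<open>x\<close>
  close to 1 the Lambert series exceeds this error.\<close>

lemma L_pos: "L > 0"
proof -
  obtain C where C: "\<And>n. \<bar>\<Sum>k<n. real_of_int (X (int (Suc k)))\<bar> \<le> C"
    using X_partial_sums_bounded by blast
  \<comment> \<open>\<open>M > 4 * C\<close> makes \<open>M / 2\<close> exceed the error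
    \<open>2 * C\<close>. The choice of \<open>x\<close> below is such that Bernoulli's inequality
    gives \<open>x ^ M\<^sup>2 \<ge> 1 / 2\<close>.\<close>
  define M :: nat where "M = nat \<lceil>4 * C\<rceil> + 1"
  have M: "real M > 4 * C" "M > 0" unfolding M_def by linarith+
  define x where "x = 1 - 1 / (2 * real (M\<^sup>2))"
  have "1 \<le> real (M\<^sup>2)" using M(2) by (simp add: Suc_leI)
  then have "1 / (2 * real (M\<^sup>2)) \<le> 1 / 2" by (simp add: divide_le_eq)
  moreover have "1 / (2 * real (M\<^sup>2)) > 0" using M(2) by simp
  ultimately have x: "0 < x" "x < 1" unfolding x_def by linarith+
  have "1 / 2 = 1 + real (M\<^sup>2) * (- (1 / (2 * real (M\<^sup>2))))" using M(2) by simp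
  also have "\<dots> \<le> (1 + (- (1 / (2 * real (M\<^sup>2))))) ^ M\<^sup>2"
    using x by (intro Bernoulli_inequality) (simp add: x_def)
  finally have "1 / 2 \<le> x ^ M\<^sup>2" by (simp add: x_def)
  then have "real M * (1 / 2) \<le> real M * x ^ M\<^sup>2" by (intro mult_left_mono) auto
  define b where "b n = 1 / (real n * (1 - x)) - x ^ n / (1 - x ^ n)" for n
  define f where "f k = real_of_int (X (int (Suc k))) * (x ^ Suc k / (1 - x ^ Suc k))" for k
  have b_lim: "(\<lambda>k. b (Suc k)) \<longlonglongrightarrow> 0"
  proof -
    have "(\<lambda>k. 1 / real (Suc k) * (1 / (1 - x)) - x ^ Suc k / (1 - x ^ Suc k))
        \<longlonglongrightarrow> 0 * (1 / (1 - x)) - 0 / (1 - 0)"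
      using x by (intro tendsto_intros LIMSEQ_Suc[OF lim_inverse_n', unfolded inverse_eq_divide]
          LIMSEQ_Suc[OF LIMSEQ_realpow_zero]) auto
    then show ?thesis by (simp add: b_def)
  qed
  note b = summable_bounded_partial_sums[of "\<lambda>k. real_of_int (X (int (Suc k)))" C "\<lambda>k. b (Suc k)",
      OF C _ _ b_lim, unfolded b_def, OF monsky_decreasing[OF x zero_less_Suc], folded b_def]
  \<comment> \<open>The first weight is 1 for every \<open>x\<close>, so the error bound does not
    depend on \<open>x\<close>.\<close>
  have b1: "b (Suc 0) = 1" using x by (simp add: b_def flip: diff_divide_distrib)
  have "(\<lambda>k. real_of_int (X (int (Suc k))) * b (Suc k)) sums (\<Sum>k. real_of_int (X (int (Suc k))) * b (Suc k))"
    using b(1) by (rule summable_sums)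
  moreover have "(\<lambda>k. real_of_int (X (int (Suc k))) * (1 / Suc k) * (1 / (1 - x))) sums (L * (1 / (1 - x)))"
    by (intro sums_mult2 L_sums)
  ultimately have "(\<lambda>k. real_of_int (X (int (Suc k))) * (1 / Suc k) * (1 / (1 - x))
      - real_of_int (X (int (Suc k))) * b (Suc k))
      sums (L * (1 / (1 - x)) - (\<Sum>k. real_of_int (X (int (Suc k))) * b (Suc k)))"
    by (intro sums_diff)
  moreover have "real_of_int (X (int (Suc k))) * (1 / Suc k) * (1 / (1 - x))
      - real_of_int (X (int (Suc k))) * b (Suc k) = f k" for k
    by (simp add: b_def f_def right_diff_distrib del: of_nat_Suc)
  ultimately have "suminf f = L * (1 / (1 - x)) - (\<Sum>k. real_of_int (X (int (Suc k))) * b (Suc k))"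
    by (simp add: sums_iff)
  moreover have "suminf f \<ge> real M * (1 / 2)"
    using lambert_series_lower_bound[OF x, of M] \<open>real M * (1 / 2) \<le> _\<close> unfolding f_def by linarith
  ultimately have "L * (1 / (1 - x)) > 0" using b(2) M(1) unfolding b1 by linarith
  then show ?thesis using x by (simp add: zero_less_divide_iff)
qed

section \<open>Conductors of real primitive characters\<close>

lemma q_gt_2: "q > 2"
proof (rule ccontr)
  assume "\<not> q > 2"
  then have q: "q = 2" using q_gt_1 by simp
  then obtain u where u: "coprime u 2" "X u \<noteq> 1" using primitive[of 1] by auto
  then have "[u = 1] (mod int q)" using q by (auto simp: cong_def odd_iff_mod_2_eq_one)
  then show False using X_cong[of u 1] u by simp
qed

text \<open>As \<open>q\<close> divides \<open>d * d\<close>, the power \<open>(1 + d) ^ n\<close>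
  is congruent to \<open>1 + n * d\<close>. Hence all values of \<open>X\<close> on residues
  congruent to 1 modulo \<open>d\<close> are powers of \<open>X (1 + d)\<close>, and primitivity
  forbids that this be 1. If \<open>q\<close> divides \<open>n * d\<close>, the n-th power of -1 is
  1.\<close>

lemma X_1_plus:
  assumes d: "d dvd q" "d < q" "q dvd d * d"
  shows "X (1 + int d) = -1" and "q dvd n * d \<Longrightarrow> even n"
proof -
  have pow: "[(1 + int d) ^ n = 1 + int (n * d)] (mod int q)" for n
  proof -
    have "[(1 + int d) ^ n = 1 + int n * int d] (mod int d * int d)"
    proof (induction n)
      case (Suc n)
      have "[(1 + int d) * (1 + int d) ^ n = (1 + int d) * (1 + int n * int d)] (mod int d * int d)"
        by (intro cong_mult Suc cong_refl)
      also have "(1 + int d) * (1 + int n * int d) = 1 + int (Suc n) * int d + int n * (int d * int d)"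
        by (simp add: algebra_simps)
      also have "[\<dots> = 1 + int (Suc n) * int d] (mod int d * int d)"
        by (simp add: cong_def)
      finally show ?case by simp
    qed simp
    then show ?thesis using d(3) by (metis cong_dvd_modulus int_dvd_int_iff of_nat_mult)
  qed
  have X_pow: "X (1 + int d) ^ n = X (1 + int (n * d))" for n
    using X_cong[OF pow[of n]] by (simp add: X_power)
  have X1: "X (1 + int d) ^ n = 1" if "q dvd n * d" for n
  proof -
    have "[1 + int (n * d) = 1] (mod int q)"
      using that by (metis add_diff_cancel_left' cong_iff_dvd_diff int_dvd_int_iff)
    then show ?thesis using X_pow[of n] X_cong by simp
  qed
  have "X (1 + int d) \<noteq> 1"
  proof
    assume eq1: "X (1 + int d) = 1"
    obtain u where u: "[u = 1] (mod int d)" "X u \<noteq> 1" using primitive d by blast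
    then obtain k where k: "u = 1 + int d * k" by (metis cong_iff_lin cong_sym)
    define n where "n = nat (k mod int q)"
    have "[k = int n] (mod int q)" using q_pos by (simp add: n_def cong_def)
    then have "[1 + int d * k = 1 + int d * int n] (mod int q)"
      by (intro cong_add cong_mult cong_refl)
    then have "X u = X (1 + int (n * d))" unfolding k by (simp add: X_cong mult.commute)
    then show False using X_pow[of n] eq1 u by simp
  qed
  moreover have "X (1 + int d) \<noteq> 0" using X1[of q] q_pos by (auto simp: power_0_left)
  ultimately show X: "X (1 + int d) = -1" using X_values[of "1 + int d"] by auto
  show "even n" if "q dvd n * d" using X1[OF that] X by (cases "even n") auto
qed

text \<open>For \<open>b > 1\<close> put \<open>d = q / b\<close>: then \<open>q\<close> divides
  \<open>d * d\<close> and \<open>q = b * d\<close>, so \<open>X_1_plus\<close> makes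
  \<open>b\<close> even.\<close>

lemma square_divisor:
  assumes "b * b dvd q"
  shows "b = 1 \<or> even b"
proof (cases "b = 1")
  case False
  have b: "b > 1" using False assms q_pos by (cases "b = 0") auto
  obtain c where c: "q = b * b * c" using assms by blast
  have "c > 0" using c q_pos by (intro Nat.gr0I) auto
  then have "b * c dvd q" "b * c < q" "q dvd (b * c) * (b * c)" using b by (auto simp: c mult_ac)
  then show ?thesis using X_1_plus(2)[of "b * c" b] by (auto simp: c mult_ac)
qed simp

text \<open>If \<open>q = 2 * m\<close> with \<open>m\<close> odd, a unit congruent to 1 modulo
  \<open>m\<close> is also odd, hence congruent to 1 modulo \<open>q\<close>, against
  primitivity.\<close>

lemma even_imp_4_dvd:
  assumes "even q"
  shows "4 dvd q"
proof (rule ccontr)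
  assume n4: "\<not> 4 dvd q"
  obtain m where m: "q = 2 * m" using assms by blast
  have "odd m" using n4 by (auto simp: m)
  obtain u where u: "coprime u (int q)" "[u = 1] (mod int m)" "X u \<noteq> 1"
    using primitive[of m] m q_pos by auto
  have "odd u" using u(1) by (auto simp: m)
  then have "[u = 1] (mod 2)" by (simp add: cong_def odd_iff_mod_2_eq_one)
  then have "[u = 1] (mod 2 * int m)"
    using u(2) \<open>odd m\<close> by (intro coprime_cong_mult) auto
  then show False using X_cong[of u 1] u(3) by (simp add: m)
qed

text \<open>With \<open>q = 16 * c\<close>, the square of \<open>1 + 4 * c\<close> is congruent to
  \<open>1 + 8 * c\<close>, but \<open>X_1_plus\<close> gives \<open>X\<close> the value -1 at
  both.\<close>

lemma not_16_dvd: "\<not> 16 dvd q"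
proof
  assume "16 dvd q"
  then obtain c where c: "q = 16 * c" by blast
  have c0: "c > 0" using c q_pos by simp
  have "[(1 + int (4 * c)) ^ 2 = 1 + int (8 * c)] (mod int q)"
    unfolding cong_iff_dvd_diff c by (auto simp: power2_eq_square algebra_simps intro!: dvdI[of _ _ "int c"])
  then have "X (1 + int (8 * c)) = X (1 + int (4 * c)) ^ 2"
    using X_cong by (metis X_power)
  moreover have "X (1 + int (8 * c)) = -1" "X (1 + int (4 * c)) = -1"
    using c0 by (intro X_1_plus(1); auto simp: c)+
  ultimately show False by simp
qed

section \<open>Cyclotomic units\<close>

text \<open>A trace twisted by \<chi>: each exponential contributes \<open>X l * gauss_sum\<close>,
  so the coefficient stays integral.\<close>

lemma sum_X_exp_sum:
  assumes "exp_sum q f"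
  shows "\<exists>k::int. (\<Sum>t\<in>{0..<int q}. of_int (X t) * f t) = of_int k * gauss_sum"
  using assms
proof induction
  case (plus f l)
  then obtain k :: int where "(\<Sum>t\<in>{0..<int q}. of_int (X t) * f t) = of_int k * gauss_sum" by blast
  then have "(\<Sum>t\<in>{0..<int q}. of_int (X t) * (f t + e (l * t))) = of_int (k + X l) * gauss_sum"
    by (simp add: distrib_left distrib_right sum.distrib gauss_sum_twist)
  then show ?case by blast
next
  case (minus f l)
  then obtain k :: int where "(\<Sum>t\<in>{0..<int q}. of_int (X t) * f t) = of_int k * gauss_sum" by blast
  then have "(\<Sum>t\<in>{0..<int q}. of_int (X t) * (f t - e (l * t))) = of_int (k - X l) * gauss_sum"
    by (simp add: right_diff_distrib left_diff_distrib sum_subtractf gauss_sum_twist)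
  then show ?case by blast
qed (auto intro: exI[of _ 0])

text \<open>The Ramanujan sums are integers because they equal \<open>\<Sum>b. X b * X (b + k)\<close>.\<close>

lemma ramanujan_sum_Ints: "(\<Sum>t\<in>{0..<int q}. of_int (X t * X t) * e (k * t)) \<in> \<int>"
proof -
  have e_split: "e ((k + b) * t) = e (k * t) * e (t * b)" for b t
    by (simp add: algebra_simps flip: exp_frac_add)
  have "gauss_sum * (\<Sum>t\<in>{0..<int q}. of_int (X t * X t) * e (k * t))
      = (\<Sum>t\<in>{0..<int q}. of_int (X t) * e (k * t) * (of_int (X t) * gauss_sum))"
    by (simp add: sum_distrib_left mult_ac)
  also have "\<dots> = (\<Sum>t\<in>{0..<int q}. \<Sum>b\<in>{0..<int q}. of_int (X b) * (of_int (X t) * e ((k + b) * t)))"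
    by (simp only: gauss_sum_twist[symmetric] sum_distrib_left e_split) (simp add: mult_ac)
  also have "\<dots> = (\<Sum>b\<in>{0..<int q}. of_int (X b) * (of_int (X (k + b)) * gauss_sum))"
    by (subst sum.swap) (simp add: gauss_sum_twist flip: sum_distrib_left)
  also have "\<dots> = gauss_sum * of_int (\<Sum>b\<in>{0..<int q}. X b * X (k + b))"
    by (simp add: sum_distrib_left mult_ac)
  finally show ?thesis using norm_gauss_sum_pos by auto
qed

text \<open>\<open>X t * X t\<close> is 1 on units and 0 elsewhere, so this is the trace from the
  cyclotomic field; on a single exponential it is a Ramanujan sum.\<close>

lemma sum_conjugates_Ints:
  assumes "exp_sum q f"
  shows "(\<Sum>t\<in>{0..<int q}. of_int (X t * X t) * f t) \<in> \<int>"
  using assms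
proof induction
  case (plus f l)
  then show ?case using Ints_add[OF _ ramanujan_sum_Ints[of l]] by (simp add: distrib_left sum.distrib)
next
  case (minus f l)
  then show ?case using Ints_diff[OF _ ramanujan_sum_Ints[of l]]
    by (simp add: right_diff_distrib sum_subtractf)
qed auto

text \<open>Euler's totient of \<open>q\<close>, written with the weights that occur in the
  traces.\<close>

definition phi :: nat where "phi = nat (\<Sum>t\<in>{0..<int q}. X t * X t)"

lemma phi: "int phi = (\<Sum>t\<in>{0..<int q}. X t * X t)" "phi > 0"
proof -
  have "(\<Sum>t\<in>{0..<int q}. X t * X t) \<ge> (\<Sum>t\<in>{1}. X t * X t)"
    using q_gt_1 by (intro sum_mono2) auto
  then show "int phi = (\<Sum>t\<in>{0..<int q}. X t * X t)" "phi > 0"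
    unfolding phi_def by simp_all
qed

text \<open>All powers of \<open>f\<close> are constant on units too, so \<open>phi * z ^ k\<close>
  is a trace and therefore an integer for every \<open>k\<close>.\<close>

lemma invariant_exp_sum_Ints:
  assumes f: "exp_sum q f" and z: "\<And>t. coprime t (int q) \<Longrightarrow> f t = z"
  shows "z \<in> \<int>"
proof (rule Ints_if_power_denominators_bounded[OF phi(2)])
  fix k
  have "(\<Sum>t\<in>{0..<int q}. of_int (X t * X t) * f t ^ k) = (\<Sum>t\<in>{0..<int q}. of_int (X t * X t) * z ^ k)"
  proof (rule sum.cong[OF refl])
    fix t
    show "of_int (X t * X t) * f t ^ k = of_int (X t * X t) * z ^ k"
      using z[of t] X_eq_0_iff[of t] by (cases "X t = 0") auto
  qed
  also have "\<dots> = of_int (int phi) * z ^ k" by (simp only: phi(1) of_int_sum sum_distrib_right)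
  finally show "of_nat phi * z ^ k \<in> \<int>"
    using sum_conjugates_Ints[OF exp_sum_power[OF f, of k]] by simp
qed

section \<open>Representatives of the units modulo sign\<close>

definition half :: "int \<Rightarrow> int set" where
  "half \<epsilon> = {a \<in> {0<..<int q}. 2 * a < int q \<and> X a = \<epsilon>}"

text \<open>Folds a residue class onto the member of the pair \<open>b\<close>, \<open>q - b\<close>
  in the lower half; on units the result lies in \<open>half 1\<close> or
  \<open>half (-1)\<close>.\<close>

definition half_rep :: "int \<Rightarrow> int" where
  "half_rep a = (let b = a mod int q in if 2 * b < int q then b else int q - b)"

lemma finite_half [simp]: "finite (half \<epsilon>)"
  by (rule finite_subset[of _ "{0<..<int q}"]) (auto simp: half_def)

lemma half_rep_cases: "[half_rep a = a] (mod int q) \<or> [half_rep a = - a] (mod int q)"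
proof -
  have "[int q - a mod int q = - a] (mod int q)" by (simp add: cong_def mod_simps)
  then show ?thesis by (simp add: half_rep_def Let_def cong_def)
qed

lemma even_periodic_half_rep:
  assumes "\<And>a b. [a = b] (mod int q) \<Longrightarrow> P a = P b" "\<And>a. P (- a) = P a"
  shows "P (half_rep a) = P a"
  using half_rep_cases[of a] assms by metis

lemma X_half_rep: "X (half_rep a) = X a"
  by (rule even_periodic_half_rep) (auto intro: X_cong)

text \<open>A unit residue equal to \<open>q / 2\<close> would divide \<open>q\<close>, hence be 1
  and force \<open>q = 2\<close>. So the strict inequality in \<open>half\<close> loses no
  unit.\<close>

lemma half_double_neq:
  assumes "X a \<noteq> 0"
  shows "2 * (a mod int q) \<noteq> int q"
proof
  assume eq: "2 * (a mod int q) = int q"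
  have "coprime (a mod int q) (int q)" using assms X_eq_0_iff q_pos by simp
  moreover have "a mod int q dvd int q" using eq by (metis dvd_triv_right)
  ultimately have "is_unit (a mod int q)" by (metis coprime_common_divisor dvd_refl)
  moreover have "a mod int q \<ge> 0" using q_pos by simp
  ultimately have "a mod int q = 1" by simp
  then show False using eq q_gt_2 by simp
qed

lemma half_rep_in_half:
  assumes "X a = \<epsilon>" "\<epsilon> \<noteq> 0"
  shows "half_rep a \<in> half \<epsilon>"
proof -
  have "a mod int q \<noteq> 0"
  proof
    assume "a mod int q = 0"
    then have "[a = 0] (mod int q)" by (simp add: cong_def)
    then show False using X_cong[of a 0] assms by simp
  qed
  moreover have "a mod int q \<ge> 0" "a mod int q < int q" using q_pos by simp_all
  moreover have "2 * (a mod int q) \<noteq> int q" using half_double_neq[of a] assms by simp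
  ultimately have "0 < half_rep a" "half_rep a < int q" "2 * half_rep a < int q"
    by (auto simp: half_rep_def Let_def)
  then show ?thesis using X_half_rep[of a] assms by (simp add: half_def)
qed

lemma half_rep_eq:
  assumes a: "a \<in> half \<epsilon>" and b: "[b = a] (mod int q) \<or> [b = - a] (mod int q)"
  shows "half_rep b = a"
proof -
  have a': "0 < a" "2 * a < int q" using a by (auto simp: half_def)
  from b show ?thesis
  proof
    assume "[b = a] (mod int q)"
    then have "b mod int q = a" using a' by (simp add: cong_def)
    then show ?thesis using a' by (simp add: half_rep_def)
  next
    assume "[b = - a] (mod int q)"
    then have "b mod int q = int q - a" using a' by (simp add: cong_def zmod_zminus1_eq_if)
    then show ?thesis using a' by (simp add: half_rep_def)
  qed
qed

text \<open>Multiplication by \<open>u\<close> followed by folding is a bijection of half systems,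
  inverted by an inverse of \<open>u\<close> modulo \<open>q\<close>; it exchanges the signs when
  \<open>X u = -1\<close>.\<close>

lemma prod_half_mult:
  fixes P :: "int \<Rightarrow> 'a :: comm_monoid_mult"
  assumes P: "\<And>a b. [a = b] (mod int q) \<Longrightarrow> P a = P b" "\<And>a. P (- a) = P a"
    and u: "coprime u (int q)" and \<epsilon>: "\<epsilon> \<noteq> 0"
  shows "(\<Prod>a\<in>half \<epsilon>. P (u * a)) = (\<Prod>a\<in>half (X u * \<epsilon>). P a)"
proof -
  obtain v where v: "[u * v = 1] (mod int q)" using u cong_solve_coprime_int by blast
  have uv: "X u * X v = 1" using X_cong[OF v] by (simp add: X_mult)
  have inverse: "half_rep (y * half_rep (x * a)) = a"
    if "a \<in> half \<delta>" "[x * y = 1] (mod int q)" for a x y \<delta>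
  proof (rule half_rep_eq[OF that(1)])
    have "[y * half_rep (x * a) = y * (x * a)] (mod int q) \<or> [y * half_rep (x * a) = y * - (x * a)] (mod int q)"
      using half_rep_cases[of "x * a"] cong_scalar_left by blast
    moreover have "[y * (x * a) = a] (mod int q)"
      using cong_scalar_right[OF that(2), of a] by (simp add: mult_ac)
    moreover have "[y * - (x * a) = - a] (mod int q)"
      using cong_scalar_right[OF that(2), of "- a"] by (simp add: mult_ac)
    ultimately show "[y * half_rep (x * a) = a] (mod int q) \<or> [y * half_rep (x * a) = - a] (mod int q)"
      using cong_trans by blast
  qed
  show ?thesis
  proof (rule prod.reindex_bij_witness[where i = "\<lambda>a. half_rep (v * a)" and j = "\<lambda>a. half_rep (u * a)"])
    fix a assume a: "a \<in> half \<epsilon>"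
    show "half_rep (v * half_rep (u * a)) = a" using a v by (rule inverse)
    have "X (u * a) = X u * \<epsilon>" using a by (simp add: half_def X_mult)
    then show "half_rep (u * a) \<in> half (X u * \<epsilon>)" using \<epsilon> uv by (intro half_rep_in_half) auto
    show "P (half_rep (u * a)) = P (u * a)" using P by (rule even_periodic_half_rep[of P])
  next
    fix a assume a: "a \<in> half (X u * \<epsilon>)"
    show "half_rep (u * half_rep (v * a)) = a" using a v by (intro inverse) (simp_all add: mult.commute)
    have "X (v * a) = (X u * X v) * \<epsilon>" using a by (simp add: half_def X_mult mult_ac)
    then show "half_rep (v * a) \<in> half \<epsilon>" using \<epsilon> uv by (intro half_rep_in_half) auto
  qed
qed

text \<open>\<open>X\<close> and \<open>F\<close> are even, so \<open>a\<close> and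
  \<open>q - a\<close> contribute equally; this is the source of the factor 2.\<close>

lemma sum_X_eq_half:
  fixes F :: "int \<Rightarrow> real"
  assumes F: "\<And>a b. [a = b] (mod int q) \<Longrightarrow> F a = F b" "\<And>a. F (- a) = F a"
  shows "(\<Sum>a\<in>{0..<int q}. of_int (X a) * F a) = 2 * ((\<Sum>a\<in>half 1. F a) - (\<Sum>a\<in>half (-1). F a))"
proof -
  define H where "H = half 1 \<union> half (-1)"
  define G where "G a = of_int (X a) * F a" for a
  have fin: "finite H" by (simp add: H_def)
  have H: "a \<in> H \<longleftrightarrow> 0 < a \<and> 2 * a < int q \<and> X a \<noteq> 0" for a
    using X_values[of a] by (auto simp: H_def half_def)
  have G: "G (int q - a) = G a" for a
  proof -
    have "[int q - a = - a] (mod int q)" by (simp add: cong_def)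
    then have "X (int q - a) = X (- a)" "F (int q - a) = F (- a)" by (rule X_cong, rule F(1))
    then show ?thesis by (simp add: G_def F)
  qed
  have "(\<Sum>a\<in>{0..<int q}. G a) = (\<Sum>a\<in>H \<union> (\<lambda>a. int q - a) ` H. G a)"
  proof (rule sum.mono_neutral_right)
    show "H \<union> (\<lambda>a. int q - a) ` H \<subseteq> {0..<int q}" by (auto simp: H)
    show "\<forall>a\<in>{0..<int q} - (H \<union> (\<lambda>a. int q - a) ` H). G a = 0"
    proof
      fix a assume a: "a \<in> {0..<int q} - (H \<union> (\<lambda>a. int q - a) ` H)"
      show "G a = 0"
      proof (rule ccontr)
        assume "G a \<noteq> 0"
        then have X: "X a \<noteq> 0" by (auto simp: G_def)
        have "a \<noteq> 0" using X by auto
        moreover have "2 * a \<noteq> int q" using half_double_neq[OF X] a by simp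
        moreover have "X (int q - a) \<noteq> 0"
          using X X_periodic[of "- a"] by (simp add: add.commute)
        ultimately have "a \<in> H \<or> int q - a \<in> H" using a X by (auto simp: H)
        then show False using a by force
      qed
    qed
  qed simp
  also have "\<dots> = (\<Sum>a\<in>H. G a) + (\<Sum>a\<in>(\<lambda>a. int q - a) ` H. G a)"
    by (rule sum.union_disjoint) (use fin in \<open>auto simp: H\<close>)
  also have "(\<Sum>a\<in>(\<lambda>a. int q - a) ` H. G a) = (\<Sum>a\<in>H. G a)"
    by (subst sum.reindex) (auto simp: inj_on_def G)
  also have "(\<Sum>a\<in>H. G a) = (\<Sum>a\<in>half 1. G a) + (\<Sum>a\<in>half (-1). G a)"
    unfolding H_def by (rule sum.union_disjoint[OF finite_half finite_half]) (auto simp: half_def)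
  also have "(\<Sum>a\<in>half 1. G a) = (\<Sum>a\<in>half 1. F a)"
    by (intro sum.cong) (auto simp: half_def G_def)
  also have "(\<Sum>a\<in>half (-1). G a) = - (\<Sum>a\<in>half (-1). F a)"
    unfolding sum_negf[symmetric] by (intro sum.cong) (auto simp: half_def G_def)
  finally show ?thesis by (simp add: G_def)
qed

section \<open>The unit and its conjugate\<close>

definition theta :: "nat \<Rightarrow> int \<Rightarrow> complex" where
  "theta h t = (\<Prod>a\<in>half 1. dirichlet_kernel q h (t * a))"

text \<open>For \<open>\<epsilon> = 1\<close> and \<open>\<epsilon> = -1\<close> these are \<theta>
  and \<theta>', with \<open>g = 2 * h + 1\<close>.\<close>

definition real_unit :: "nat \<Rightarrow> int \<Rightarrow> complex" where
  "real_unit h \<epsilon> = (\<Prod>a\<in>half \<epsilon>. dirichlet_kernel q h a)"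

lemma exp_sum_theta: "exp_sum q (theta h)"
  unfolding theta_def by (intro exp_sum_prod exp_sum_dirichlet_kernel) simp

text \<open>Multiplication by \<open>t\<close> carries \<open>half 1\<close> to
  \<open>half (X t)\<close>, so a conjugate depends on \<open>t\<close> only through
  \<open>X t\<close>.\<close>

lemma theta_eq_real_unit:
  assumes "coprime t (int q)"
  shows "theta h t = real_unit h (X t)"
  using prod_half_mult[of "dirichlet_kernel q h" t 1] assms
  by (simp add: theta_def real_unit_def dirichlet_kernel_cong[OF q_pos] dirichlet_kernel_minus)

lemma real_unit_real: "real_unit h \<epsilon> = of_real (Re (real_unit h \<epsilon>))"
proof -
  have "cnj (real_unit h \<epsilon>) = real_unit h \<epsilon>" by (simp add: real_unit_def cnj_dirichlet_kernel)
  then show ?thesis by (simp add: complex_eq_iff)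
qed

lemma norm_1_minus_e_minus: "norm (1 - e (- a)) = norm (1 - e a)"
proof -
  have "1 - e (- a) = cnj (1 - e a)" by (simp add: exp_frac_minus)
  then show ?thesis by (metis complex_mod_cnj)
qed

text \<open>Each kernel is a quotient of norms, and since \<open>X (2 * h + 1) = -1\<close> the
  multiplier moves the product of the numerators to the opposite half.\<close>

lemma norm_real_unit:
  assumes h: "X (2 * int h + 1) = -1" and \<epsilon>: "\<epsilon> \<in> {1, -1}"
  shows "norm (real_unit h \<epsilon>) = (\<Prod>a\<in>half (- \<epsilon>). norm (1 - e a)) / (\<Prod>a\<in>half \<epsilon>. norm (1 - e a))"
proof -
  have "norm (real_unit h \<epsilon>) = (\<Prod>a\<in>half \<epsilon>. norm (1 - e ((2 * int h + 1) * a)) / norm (1 - e a))"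
    unfolding real_unit_def prod_norm[symmetric]
  proof (rule prod.cong[OF refl])
    fix a assume "a \<in> half \<epsilon>"
    then have "e a \<noteq> 1" using e_ne_1[of a] \<epsilon> by (auto simp: half_def)
    moreover have "norm (1 - e a) * norm (dirichlet_kernel q h a) = norm (1 - e ((2 * int h + 1) * a))"
      unfolding norm_mult[symmetric] dirichlet_kernel_mult by (simp add: norm_mult)
    ultimately show "norm (dirichlet_kernel q h a) = norm (1 - e ((2 * int h + 1) * a)) / norm (1 - e a)"
      by (simp add: field_simps)
  qed
  also have "\<dots> = (\<Prod>a\<in>half \<epsilon>. norm (1 - e ((2 * int h + 1) * a))) / (\<Prod>a\<in>half \<epsilon>. norm (1 - e a))"
    by (rule prod_dividef)
  also have "(\<Prod>a\<in>half \<epsilon>. norm (1 - e ((2 * int h + 1) * a))) = (\<Prod>a\<in>half (X (2 * int h + 1) * \<epsilon>). norm (1 - e a))"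
  proof (rule prod_half_mult)
    show "norm (1 - e a) = norm (1 - e b)" if "[a = b] (mod int q)" for a b
      using e_cong[OF that] by simp
  qed (use norm_1_minus_e_minus h \<epsilon> X_eq_0_iff[of "2 * int h + 1"] in auto)
  finally show ?thesis by (simp add: h)
qed

lemma prod_half_pos:
  assumes "\<epsilon> \<noteq> 0"
  shows "(\<Prod>a\<in>half \<epsilon>. norm (1 - e a)) > 0"
  by (rule prod_pos) (use e_ne_1 assms in \<open>auto simp: half_def\<close>)

lemma norm_real_unit_mult:
  assumes "X (2 * int h + 1) = -1"
  shows "norm (real_unit h 1) * norm (real_unit h (-1)) = 1"
proof -
  have cancel: "v / u * (u / v) = 1" if "u > 0" "v > 0" for u v :: real
    using that by simp
  show ?thesis
    using cancel[OF prod_half_pos[of 1] prod_half_pos[of "-1"]]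
    by (simp only: norm_real_unit[OF assms, of 1, simplified] norm_real_unit[OF assms, of "-1", simplified])
qed

text \<open>The logarithm of the norm quotient is, up to sign, half of the sum in
  \<open>L_log_formula\<close>, because that sum counts both \<open>a\<close> and
  \<open>q - a\<close>.\<close>

lemma ln_norm_real_unit:
  assumes "X (2 * int h + 1) = -1"
  shows "2 * ln (norm (real_unit h 1)) = Re gauss_sum * L"
proof -
  have ln_half: "ln (\<Prod>a\<in>half \<epsilon>. norm (1 - e a)) = (\<Sum>a\<in>half \<epsilon>. ln (norm (1 - e a)))" if "\<epsilon> \<noteq> 0" for \<epsilon>
    by (rule ln_prod[OF finite_half]) (use e_ne_1 that in \<open>auto simp: half_def\<close>)
  have "(\<Sum>a\<in>{0..<int q}. of_int (X a) * ln (norm (1 - e a)))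
      = 2 * ((\<Sum>a\<in>half 1. ln (norm (1 - e a))) - (\<Sum>a\<in>half (-1). ln (norm (1 - e a))))"
  proof (rule sum_X_eq_half)
    show "ln (norm (1 - e a)) = ln (norm (1 - e b))" if "[a = b] (mod int q)" for a b
      using e_cong[OF that] by simp
  qed (simp add: norm_1_minus_e_minus)
  moreover have "norm (real_unit h 1) = (\<Prod>a\<in>half (-1). norm (1 - e a)) / (\<Prod>a\<in>half 1. norm (1 - e a))"
    using norm_real_unit[OF assms, of 1] by simp
  moreover have "(\<Prod>a\<in>half (-1). norm (1 - e a)) > 0" "(\<Prod>a\<in>half 1. norm (1 - e a)) > 0"
    by (simp_all only: prod_half_pos one_neq_zero neg_equal_0_iff_equal not_False_eq_True)
  ultimately show ?thesis
    by (simp only: L_log_formula ln_divide_pos) (simp add: ln_half)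
qed

text \<open>On units \<open>theta h t = s + X t * d\<close>, where \<open>s\<close> and
  \<open>d\<close> are half the sum and half the difference of the conjugates. The sum twisted by
  \<open>X\<close> kills \<open>s\<close> and leaves \<open>phi * d\<close>, while
  \<open>sum_X_exp_sum\<close> makes it an integer multiple of the Gauss sum.\<close>

lemma real_unit_diff:
  "\<exists>k::int. real_unit h 1 - real_unit h (-1) = of_real (of_int k / of_nat phi) * gauss_sum"
proof -
  obtain k :: int where k: "(\<Sum>t\<in>{0..<int q}. of_int (X t) * theta h t) = of_int k * gauss_sum"
    using sum_X_exp_sum[OF exp_sum_theta] by blast
  define s d where "s = (real_unit h 1 + real_unit h (-1)) / 2" and "d = (real_unit h 1 - real_unit h (-1)) / 2"
  have "(\<Sum>t\<in>{0..<int q}. of_int (X t) * theta h t)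
      = (\<Sum>t\<in>{0..<int q}. of_int (X t) * s + of_int (X t * X t) * d)"
  proof (rule sum.cong[OF refl])
    fix t
    show "of_int (X t) * theta h t = of_int (X t) * s + of_int (X t * X t) * d"
    proof (cases "X t = 0")
      case False
      then have "coprime t (int q)" using X_eq_0_iff by simp
      then show ?thesis using theta_eq_real_unit[of t h] X_values[of t] False
        by (auto simp: s_def d_def field_simps)
    qed simp
  qed
  also have "\<dots> = (\<Sum>t\<in>{0..<int q}. of_int (X t)) * s + of_int (\<Sum>t\<in>{0..<int q}. X t * X t) * d"
    by (simp only: sum.distrib sum_distrib_right of_int_sum)
  \<comment> \<open>This is the twist by 0.\<close>
  also have "(\<Sum>t\<in>{0..<int q}. of_int (X t)) = (0 :: complex)"
    using gauss_sum_twist[of 0] by simp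
  finally have "of_int k * gauss_sum = of_nat phi * d" by (simp add: k flip: phi(1))
  then have "real_unit h 1 - real_unit h (-1) = of_real (of_int (2 * k) / of_nat phi) * gauss_sum"
    using phi(2) by (simp add: d_def field_simps)
  then show ?thesis by blast
qed

text \<open>As \<open>e (q / 2) = -1\<close>, replacing \<open>t\<close> by
  \<open>(1 + q / 2) * t\<close> with \<open>t\<close> odd multiplies \<open>e (k * t)\<close> by
  the parity sign of \<open>k\<close>: odd frequencies cancel and even ones double.\<close>

lemma exp_sum_even_part:
  assumes q: "even q" and f: "exp_sum q f"
  shows "\<exists>f'. exp_sum q f' \<and> (\<forall>t. odd t \<longrightarrow> f t + f ((1 + int (q div 2)) * t) = 2 * f' t)"
proof -
  have monom: "e (k * t) + e (k * ((1 + int (q div 2)) * t)) = 2 * (if even k then e (k * t) else 0)"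
    if "odd t" for k t
  proof -
    have q2: "int q = 2 * int (q div 2)" using q by auto
    have half_turn: "e (int (q div 2)) = -1"
    proof -
      have "2 * pi * of_int (int (q div 2)) / of_nat q = pi" using q q_pos by (auto elim!: evenE)
      then show ?thesis by (simp only: exp_frac_def) (simp add: complex_eq_iff)
    qed
    obtain m where kt: "k * t = 2 * m \<and> even k \<or> k * t = 2 * m + 1 \<and> odd k"
    proof (cases "even k")
      case True
      then show ?thesis using that by (auto elim!: evenE)
    next
      case False
      then have "odd (k * t)" using \<open>odd t\<close> by simp
      then obtain m where "k * t = 2 * m + 1" by (rule oddE)
      then show ?thesis using that False by blast
    qed
    have "e (2 * m * int (q div 2)) = 1"
      using exp_frac_eq_1_iff[OF q_pos, of "2 * m * int (q div 2)"] q2 by (simp add: mult_ac)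
    then have "e (k * t * int (q div 2)) = (if even k then 1 else -1)"
      using kt by (auto simp: distrib_right exp_frac_add half_turn)
    moreover have "e (k * ((1 + int (q div 2)) * t)) = e (k * t) * e (k * t * int (q div 2))"
      by (simp add: algebra_simps flip: exp_frac_add)
    ultimately show ?thesis by simp
  qed
  from f show ?thesis
  proof induction
    case zero
    then show ?case by (intro exI[of _ "\<lambda>_. 0"]) (simp add: exp_sum.zero)
  next
    case (plus f k)
    then obtain f' where f': "exp_sum q f'" "\<And>t. odd t \<Longrightarrow> f t + f ((1 + int (q div 2)) * t) = 2 * f' t"
      by blast
    have "exp_sum q (\<lambda>t. f' t + (if even k then e (k * t) else 0))"
      using f'(1) by (cases "even k") (simp_all add: exp_sum.plus)
    moreover have "f t + e (k * t) + (f ((1 + int (q div 2)) * t) + e (k * ((1 + int (q div 2)) * t)))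
        = 2 * (f' t + (if even k then e (k * t) else 0))" if "odd t" for t
      unfolding distrib_left f'(2)[OF that, symmetric] monom[OF that, of k, symmetric] by simp
    ultimately show ?case by blast
  next
    case (minus f k)
    then obtain f' where f': "exp_sum q f'" "\<And>t. odd t \<Longrightarrow> f t + f ((1 + int (q div 2)) * t) = 2 * f' t"
      by blast
    have "exp_sum q (\<lambda>t. f' t - (if even k then e (k * t) else 0))"
      using f'(1) by (cases "even k") (simp_all add: exp_sum.minus)
    moreover have "f t - e (k * t) + (f ((1 + int (q div 2)) * t) - e (k * ((1 + int (q div 2)) * t)))
        = 2 * (f' t - (if even k then e (k * t) else 0))" if "odd t" for t
      unfolding right_diff_distrib f'(2)[OF that, symmetric] monom[OF that, of k, symmetric] by simp
    ultimately show ?case by blast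
  qed
qed

lemma theta_trace:
  assumes X: "X u = -1" and t: "coprime t (int q)"
  shows "theta h t + theta h (u * t) = real_unit h 1 + real_unit h (-1)"
proof -
  have "coprime (u * t) (int q)"
    using t X X_eq_0_iff[of t] X_eq_0_iff[of "u * t"] by (simp add: X_mult)
  then show ?thesis
    using t X_values[of t] X_eq_0_iff[of t] by (auto simp: theta_eq_real_unit X_mult X)
qed

text \<open>Multiplication by \<open>2 * h + 1\<close> exchanges the two values of
  \<open>theta h\<close> on units, so their sum is an invariant exponential sum.\<close>

lemma real_unit_sum_Ints:
  assumes h: "X (2 * int h + 1) = -1"
  shows "real_unit h 1 + real_unit h (-1) \<in> \<int>"
proof (rule invariant_exp_sum_Ints)
  show "exp_sum q (\<lambda>t. theta h t + theta h ((2 * int h + 1) * t))"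
    by (intro exp_sum_add exp_sum_scale exp_sum_theta)
qed (rule theta_trace[OF h])

text \<open>The choice of \<open>h\<close> makes the multiplier \<open>1 + q / 2\<close>, so
  \<open>exp_sum_even_part\<close> exhibits half of the trace as an exponential sum. This gain of 2
  is what allows passing from \<open>q\<close> to \<open>q / 4\<close>.\<close>

lemma real_unit_half_sum_Ints:
  assumes q: "even q" and h: "2 * h = q div 2" and X: "X (2 * int h + 1) = -1"
  shows "(real_unit h 1 + real_unit h (-1)) / 2 \<in> \<int>"
proof -
  have g: "1 + int (q div 2) = 2 * int h + 1" using h by simp
  obtain f where f: "exp_sum q f" "\<And>t. odd t \<Longrightarrow> theta h t + theta h ((2 * int h + 1) * t) = 2 * f t"
    using exp_sum_even_part[OF q exp_sum_theta[of h]] unfolding g by blast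
  show ?thesis
  proof (rule invariant_exp_sum_Ints[OF f(1)])
    fix t assume t: "coprime t (int q)"
    then have "odd t" using q by (metis coprime_common_divisor even_of_nat odd_one)
    then have "2 * f t = real_unit h 1 + real_unit h (-1)" using f(2)[OF \<open>odd t\<close>] theta_trace[OF X t, of h] by simp
    then show "f t = (real_unit h 1 + real_unit h (-1)) / 2"
      by (metis nonzero_mult_div_cancel_left zero_neq_numeral)
  qed
qed

section \<open>From the units to the lower bound for L(1, \<chi>)\<close>

lemma norm_gauss_sum: "norm gauss_sum = sqrt q"
proof -
  have "norm gauss_sum ^ 2 = real q" by (metis gauss_sum_square norm_of_nat norm_power)
  then show ?thesis by (metis norm_ge_zero real_sqrt_unique)
qed

lemma gauss_sum_real: "gauss_sum = of_real (Re gauss_sum)"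
  using gauss_sum_cnj by (simp add: complex_eq_iff)

text \<open>
  The conjugate units differ by a nonzero rational multiple \<open>r\<close> of the Gauss sum. For odd \<open>q\<close> the number \<open>r\<^sup>2 * q\<close> is
  an integer and \<open>q\<close> is squarefree; for even \<open>q\<close> the same holds with \<open>q / 4\<close> because the trace is even. So
  \<open>r\<close> is an integer.
\<close>

lemma norm_units_lower_bound:
  assumes h: "X (2 * int h + 1) = -1"
    and 4: "even q \<Longrightarrow> 2 * h = q div 2"
  shows "sqrt q \<le> norm (real_unit h 1) + norm (real_unit h (-1))"
proof -
  define A B where "A = Re (real_unit h 1)" and "B = Re (real_unit h (-1))"
  have AB: "real_unit h 1 = of_real A" "real_unit h (-1) = of_real B"
    unfolding A_def B_def by (rule real_unit_real)+
  have norm_AB: "\<bar>A\<bar> * \<bar>B\<bar> = 1" using norm_real_unit_mult[OF h] by (simp add: AB)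
  obtain k :: int where k: "real_unit h 1 - real_unit h (-1) = of_real (of_int k / of_nat phi) * gauss_sum"
    using real_unit_diff by blast
  define r where "r = real_of_int k / of_nat phi"
  define \<tau> where "\<tau> = Re gauss_sum"
  have \<tau>: "gauss_sum = of_real \<tau>" unfolding \<tau>_def by (rule gauss_sum_real)
  have \<tau>2: "\<tau> ^ 2 = real q"
  proof -
    have "complex_of_real (\<tau> ^ 2) = of_real (real q)" using gauss_sum_square by (simp add: \<tau>)
    then show ?thesis by (rule of_real_eq_iff[THEN iffD1])
  qed
  have diff: "A - B = r * \<tau>"
  proof -
    have "complex_of_real (A - B) = of_real (r * \<tau>)" using k by (simp add: AB \<tau> r_def)
    then show ?thesis by (rule of_real_eq_iff[THEN iffD1])
  qed
  have prod_Ints: "A * B \<in> \<int>"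
  proof -
    have "\<bar>A * B\<bar> = 1" using norm_AB by (simp add: abs_mult)
    then have "A * B = 1 \<or> A * B = -1" by linarith
    then show ?thesis by auto
  qed
  have real_Ints: "x \<in> \<int>" if "complex_of_real x \<in> \<int>" for x
    using that by (metis Ints_cases Ints_of_int of_real_eq_iff of_real_of_int_eq)
  have "r \<in> \<int>"
  proof (cases "even q")
    case True
    have "4 dvd q" using True by (rule even_imp_4_dvd)
    then obtain m where m: "q = 4 * m" by blast
    have "complex_of_real ((A + B) / 2) \<in> \<int>"
      using real_unit_half_sum_Ints[OF True 4[OF True] h] by (simp add: AB)
    then have "(A + B) / 2 \<in> \<int>" by (rule real_Ints)
    \<comment> \<open>A quarter of the discriminant of the quadratic polynomial with roots
      \<open>A\<close> and \<open>B\<close>.\<close>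
    then have "((A + B) / 2) ^ 2 - A * B \<in> \<int>" using prod_Ints by (intro Ints_diff Ints_power)
    also have "((A + B) / 2) ^ 2 - A * B = ((A - B) / 2) ^ 2"
      by (simp add: power2_eq_square field_simps)
    also have "\<dots> = r ^ 2 * real m"
      using \<tau>2 by (simp add: diff m power_divide power_mult_distrib)
    finally show "r \<in> \<int>" unfolding r_def
    proof (rule Ints_if_square_times_squarefree[OF phi(2), rotated])
      fix b :: int assume b: "b * b dvd int m" "b > 0"
      define c where "c = nat b"
      have bc: "b = int c" using b by (simp add: c_def)
      have c: "c * c dvd m" using b(1) unfolding bc by (simp flip: of_nat_mult)
      then have "c = 1 \<or> even c" using square_divisor[of c] m by (simp add: dvd_mult)
      moreover have "odd c"
      proof
        assume "even c"
        then have "2 * 2 dvd c * c" by (intro mult_dvd_mono)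
        then have "16 dvd q" using c m by auto
        then show False using not_16_dvd by simp
      qed
      ultimately show "b = 1" by (simp add: bc)
    qed
  next
    case False
    have "complex_of_real (A + B) \<in> \<int>" using real_unit_sum_Ints[OF h] by (simp add: AB)
    then have "A + B \<in> \<int>" by (rule real_Ints)
    then have "(A + B) ^ 2 - 4 * (A * B) \<in> \<int>" using prod_Ints by (intro Ints_diff Ints_power Ints_mult[of 4 "A * B"]) auto
    also have "(A + B) ^ 2 - 4 * (A * B) = (A - B) ^ 2" by (simp add: power2_eq_square algebra_simps)
    also have "\<dots> = r ^ 2 * real q" using \<tau>2 by (simp add: diff power_mult_distrib)
    finally show "r \<in> \<int>" unfolding r_def
    proof (rule Ints_if_square_times_squarefree[OF phi(2), rotated])
      fix b :: int assume b: "b * b dvd int q" "b > 0"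
      define c where "c = nat b"
      have bc: "b = int c" using b by (simp add: c_def)
      have c: "c * c dvd q" using b(1) unfolding bc by (simp flip: of_nat_mult)
      then have "c = 1 \<or> even c" by (rule square_divisor)
      moreover have "odd c" using c False by (meson dvd_mult_left dvd_trans)
      ultimately show "b = 1" by (simp add: bc)
    qed
  qed
  \<comment> \<open>Equal conjugates would have norm 1, and then \<open>ln_norm_real_unit\<close>
    would contradict \<open>L_pos\<close>.\<close>
  moreover have "r \<noteq> 0"
  proof
    assume "r = 0"
    then have "\<bar>A\<bar> * \<bar>A\<bar> = 1" using diff norm_AB by simp
    then have "norm (real_unit h 1) = 1"
      by (metis AB(1) abs_1 abs_ge_zero abs_mult_self_eq mult_1 norm_of_real power2_eq_1_iff power2_eq_square real_sqrt_abs real_sqrt_one)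
    then have "\<tau> * L = 0" using ln_norm_real_unit[OF h] by (simp add: \<tau>_def)
    then show False using L_pos \<tau>2 q_pos by auto
  qed
  ultimately have "\<bar>r\<bar> \<ge> 1" by (auto elim!: Ints_cases)
  have "sqrt q = \<bar>\<tau>\<bar>" using \<tau>2 by (metis real_sqrt_abs)
  also have "\<dots> \<le> \<bar>r\<bar> * \<bar>\<tau>\<bar>" using mult_right_mono[OF \<open>\<bar>r\<bar> \<ge> 1\<close>, of "\<bar>\<tau>\<bar>"] by simp
  also have "\<dots> = \<bar>A - B\<bar>" by (simp add: diff abs_mult)
  also have "\<dots> \<le> \<bar>A\<bar> + \<bar>B\<bar>" by simp
  finally show ?thesis by (simp add: AB)
qed

text \<open>For even \<open>q\<close> the number \<open>1 + q / 2\<close> works by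
  \<open>X_1_plus\<close>. For odd \<open>q\<close> primitivity at \<open>d = 1\<close> gives some
  \<open>u\<close> with \<open>X u = -1\<close>, and adding \<open>q\<close> if necessary makes its
  residue odd.\<close>

lemma ex_nonresidue: "\<exists>h. X (2 * int h + 1) = -1 \<and> (even q \<longrightarrow> 2 * h = q div 2)"
proof (cases "even q")
  case True
  then obtain m where m: "q = 4 * m" using even_imp_4_dvd by blast
  then have "X (1 + int (2 * m)) = -1" using q_pos by (intro X_1_plus(1)) auto
  then show ?thesis using m by (intro exI[of _ m]) (simp add: add.commute)
next
  case False
  obtain u where u: "coprime u (int q)" "X u \<noteq> 1" using primitive[of 1] q_gt_1 by auto
  then have Xu: "X u = -1" using X_values[of u] X_eq_0_iff[of u] by auto
  define v where "v = u mod int q + (if even (u mod int q) then int q else 0)"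
  have "odd v" using False by (simp add: v_def)
  have "v \<ge> 0" using q_pos by (simp add: v_def)
  have "X v = -1" using Xu X_cong[of v u] by (simp add: v_def cong_def)
  moreover obtain j where "v = 2 * j + 1" using \<open>odd v\<close> by (rule oddE)
  moreover have "int (nat j) = j" using \<open>v \<ge> 0\<close> \<open>v = 2 * j + 1\<close> by simp
  ultimately show ?thesis using False by (intro exI[of _ "nat j"]) simp
qed

text \<open>The two norms are reciprocal, so one is at most 1 and the other at least
  \<open>sqrt q - 1\<close>. The absolute value of \<open>ln a\<close> covers both cases, as well as
  the undetermined sign of the Gauss sum.\<close>

theorem L_lower_bound: "sqrt q * L \<ge> 2 * ln (sqrt q - 1)"
proof -
  obtain h where h: "X (2 * int h + 1) = -1" "even q \<longrightarrow> 2 * h = q div 2"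
    using ex_nonresidue by blast
  define a b where "a = norm (real_unit h 1)" and "b = norm (real_unit h (-1))"
  have ab: "a * b = 1" "sqrt q \<le> a + b"
    using norm_real_unit_mult[OF h(1)] norm_units_lower_bound[OF h(1)] h(2) by (auto simp: a_def b_def)
  have pos: "a > 0" "b > 0"
    using ab(1) by (metis a_def b_def mult_eq_0_iff norm_ge_zero order_le_less zero_neq_one)+
  have sqrt_q: "sqrt q > 1" using q_gt_1 by simp
  have ln_ab: "ln a + ln b = 0" using ln_mult_pos[OF pos] ab(1) by simp
  have "ln (sqrt q - 1) \<le> \<bar>ln a\<bar>"
  proof (cases "a \<le> 1")
    case True
    then have "ln (sqrt q - 1) \<le> ln b" using ab(2) sqrt_q by (intro ln_mono) auto
    then show ?thesis using ln_ab by linarith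
  next
    case False
    then have "b \<le> 1" using ab(1) pos by (metis linorder_not_le mult_less_cancel_left2 mult_le_cancel_left1 less_le_not_le less_eq_real_def)
    then have "ln (sqrt q - 1) \<le> ln a" using ab(2) sqrt_q by (intro ln_mono) auto
    then show ?thesis by linarith
  qed
  moreover have "2 * \<bar>ln a\<bar> = sqrt q * L"
  proof -
    have "2 * ln a = Re gauss_sum * L" using ln_norm_real_unit[OF h(1)] by (simp add: a_def)
    then have "\<bar>2 * ln a\<bar> = \<bar>Re gauss_sum * L\<bar>" by (rule arg_cong)
    then have "2 * \<bar>ln a\<bar> = \<bar>Re gauss_sum\<bar> * L" using L_pos by (simp add: abs_mult)
    moreover have "\<bar>Re gauss_sum\<bar> = sqrt q"
      using norm_gauss_sum gauss_sum_real by (metis norm_of_real)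
    ultimately show ?thesis by simp
  qed
  ultimately show ?thesis by linarith
qed

end

section \<open>Real primitive Dirichlet characters\<close>

text \<open>Units modulo \<open>d\<close> lift to units modulo \<open>q\<close>. The witness is
  \<open>a + d * k\<close>: a prime of \<open>q\<close> dividing \<open>a\<close> divides neither
  \<open>d\<close> nor \<open>k\<close>, and every other prime of \<open>q\<close> divides
  \<open>k\<close>.\<close>

lemma ex_coprime_cong:
  fixes a d :: int and q :: nat
  assumes a: "coprime a d" and q: "q > 0"
  shows "\<exists>b. coprime b (int q) \<and> [b = a] (mod d)"
proof -
  define P where "P = {p \<in> prime_factors (int q). \<not> p dvd a}"
  define k where "k = \<Prod>P"
  have fin: "finite P" by (simp add: P_def)
  have "coprime (a + d * k) (int q)"
  proof (rule ccontr)
    assume "\<not> coprime (a + d * k) (int q)"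
    then have "\<not> is_unit (gcd (a + d * k) (int q))" by (simp only: is_unit_gcd not_False_eq_True)
    moreover have "gcd (a + d * k) (int q) \<noteq> 0" using q by simp
    ultimately obtain p where "p dvd gcd (a + d * k) (int q)" "prime p"
      using prime_divisor_exists by blast
    then have p: "prime p" "p dvd a + d * k" "p dvd int q" by auto
    show False
    proof (cases "p dvd a")
      case True
      then have "p dvd d * k" using p(2) by (simp add: dvd_add_right_iff)
      moreover have "\<not> p dvd d"
        using True a p(1) by (metis coprime_common_divisor not_prime_unit)
      ultimately have "p dvd \<Prod>P" using p(1) by (simp add: prime_dvd_mult_iff k_def)
      then obtain p' where "p' \<in> P" "p dvd p'" using p(1) fin by (auto simp: prime_dvd_prod_iff)
      moreover from this have "p = p'" using p(1) by (auto simp: P_def intro: primes_dvd_imp_eq)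
      ultimately show False using True by (simp add: P_def)
    next
      case False
      then have "p \<in> P" using p q by (simp add: P_def prime_factors_dvd)
      then have "p dvd k" using dvd_prodI[OF fin, of p "\<lambda>p. p"] by (simp add: k_def)
      then show False using p(2) False by (simp add: dvd_add_left_iff)
    qed
  qed
  then show ?thesis by (intro exI[of _ "a + d * k"]) (simp add: cong_def)
qed

lemma dirichlet_character_cong:
  assumes "dirichlet_character q chi" "[a = b] (mod int q)"
  shows "chi a = chi b"
  by (rule periodic_cong[OF _ assms(2)]) (use assms(1) in \<open>auto simp: dirichlet_character_def\<close>)

text \<open>By contraposition: a character trivial on the units congruent to 1 modulo
  \<open>d\<close> depends only on the residue modulo \<open>d\<close>, and evaluating it at lifts
  \<open>rep a\<close> defines a character inducing it.\<close>

lemma not_induced_imp_nontrivial_kernel: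
  assumes chi: "dirichlet_character q chi" and d: "d dvd q"
    and not_induced: "\<nexists>psi. induced_by q chi d psi"
  shows "\<exists>u. coprime u (int q) \<and> [u = 1] (mod int d) \<and> chi u \<noteq> 1"
proof (rule ccontr)
  assume "\<nexists>u. coprime u (int q) \<and> [u = 1] (mod int d) \<and> chi u \<noteq> 1"
  then have trivial: "chi u = 1" if "coprime u (int q)" "[u = 1] (mod int d)" for u
    using that by blast
  have q: "q > 0" and mult: "\<And>a b. chi (a * b) = chi a * chi b"
    and nonzero: "\<And>a. chi a \<noteq> 0 \<longleftrightarrow> coprime a (int q)"
    using chi by (auto simp: dirichlet_character_def)
  have d0: "d > 0" using d q by (intro Nat.gr0I) auto
  have coprime_d: "coprime b (int d)" if "coprime b (int q)" for b
    using that d by (meson coprime_divisors dvd_refl int_dvd_int_iff)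
  have well_defined: "chi b = chi b'"
    if b: "coprime b (int q)" and b': "coprime b' (int q)" and bb': "[b = b'] (mod int d)" for b b'
  proof -
    \<comment> \<open>With \<open>c\<close> an inverse of \<open>b'\<close>, both
      \<open>b * c\<close> and \<open>b' * c\<close> are congruent to 1 modulo \<open>d\<close>, so
      \<open>chi\<close> agrees on them.\<close>
    obtain c where c: "[b' * c = 1] (mod int q)" using b' cong_solve_coprime_int by blast
    have chi_b'c: "chi (b' * c) = 1"
      using dirichlet_character_cong[OF chi c] trivial[of 1] by simp
    then have "chi c \<noteq> 0" by (auto simp: mult)
    then have "chi (b * c) \<noteq> 0" using nonzero[of b] b by (simp add: mult)
    then have cop: "coprime (b * c) (int q)" using nonzero[of "b * c"] by simp
    have "[b * c = b' * c] (mod int d)" using bb' by (rule cong_scalar_right)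
    also have "[b' * c = 1] (mod int d)" using c d by (meson cong_dvd_modulus int_dvd_int_iff)
    finally have "chi (b * c) = 1" using cop by (intro trivial)
    then have "chi b * chi c = chi b' * chi c" using chi_b'c by (simp add: mult)
    then show ?thesis using \<open>chi c \<noteq> 0\<close> by simp
  qed
  define rep where "rep a = (SOME b. coprime b (int q) \<and> [b = a] (mod int d))" for a
  have rep: "coprime (rep a) (int q)" "[rep a = a] (mod int d)" if "coprime a (int d)" for a
    using someI_ex[OF ex_coprime_cong[OF that q]] by (auto simp: rep_def)
  define psi where "psi a = (if coprime a (int d) then chi (rep a) else 0)" for a
  have psi: "psi a = chi b" if "coprime b (int q)" "[b = a] (mod int d)" for a b
  proof -
    have "coprime a (int d)" using coprime_d[OF that(1)] that(2) by (metis cong_imp_coprime)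
    then show ?thesis unfolding psi_def using that rep[of a]
      by (auto intro!: well_defined intro: cong_trans cong_sym)
  qed
  have "dirichlet_character d psi"
    unfolding dirichlet_character_def
  proof (intro conjI allI)
    show "d > 0" by (rule d0)
    fix a b
    show "psi a \<noteq> 0 \<longleftrightarrow> coprime a (int d)"
      using rep(1)[of a] nonzero by (auto simp: psi_def)
    show "psi (a + int d) = psi a"
    proof (cases "coprime a (int d)")
      case True
      have "[rep a = a + int d] (mod int d)" using rep(2)[OF True] by (simp add: cong_def)
      then have "psi (a + int d) = chi (rep a)" using rep(1)[OF True] by (intro psi)
      then show ?thesis using True by (simp add: psi_def)
    next
      case False
      then have "\<not> coprime (a + int d) (int d)" by (simp add: coprime_iff_gcd_eq_1)
      then show ?thesis using False by (simp add: psi_def)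
    qed
    show "psi (a * b) = psi a * psi b"
    proof (cases "coprime a (int d) \<and> coprime b (int d)")
      case True
      then have "coprime (rep a * rep b) (int q)" "[rep a * rep b = a * b] (mod int d)"
        using rep[of a] rep[of b] by (auto intro: cong_mult)
      then have "psi (a * b) = chi (rep a * rep b)" by (rule psi)
      then show ?thesis using True by (simp add: psi_def mult)
    next
      case False
      then have "\<not> coprime (a * b) (int d)" by auto
      then show ?thesis using False by (auto simp: psi_def)
    qed
  qed
  moreover have "\<forall>a. coprime a (int q) \<longrightarrow> chi a = psi a" using psi by simp
  ultimately show False using not_induced d by (auto simp: induced_by_def)
qed

text \<open>By Euler's theorem a value at a unit is a root of unity, and a real number of modulus 1
  is 1 or -1.\<close>

lemma real_character_values:
  assumes chi: "dirichlet_character q chi" and real: "real_character chi"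
  shows "chi a \<in> {-1, 0, 1}"
proof (cases "coprime a (int q)")
  case True
  have q: "q > 0" using chi by (simp add: dirichlet_character_def)
  obtain x where x: "chi a = of_real x" using real by (auto simp: real_character_def elim: Reals_cases)
  have "chi 1 * chi 1 = chi 1" "chi 1 \<noteq> 0"
  proof -
    have "chi (1 * 1) = chi 1 * chi 1" using chi unfolding dirichlet_character_def by blast
    then show "chi 1 * chi 1 = chi 1" by simp
    have "chi 1 \<noteq> 0 \<longleftrightarrow> coprime 1 (int q)" using chi unfolding dirichlet_character_def by blast
    then show "chi 1 \<noteq> 0" by simp
  qed
  then have chi_1: "chi 1 = 1" by simp
  have pow: "chi (a ^ n) = chi a ^ n" for n
    using chi chi_1 by (induction n) (auto simp: dirichlet_character_def)
  define b where "b = nat (a mod int q)"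
  have ab: "[int b = a] (mod int q)" using q by (simp add: b_def cong_def)
  then have "coprime b q" using True by (metis cong_imp_coprime cong_sym coprime_int_iff)
  then have "[int b ^ totient q = 1] (mod int q)"
    using euler_theorem[of b q] by (simp flip: cong_int_iff)
  then have n: "totient q > 0" "[a ^ totient q = 1] (mod int q)"
    using q cong_trans[OF cong_sym[OF cong_pow[OF ab]]] by auto
  then have "chi a ^ totient q = 1" using dirichlet_character_cong[OF chi n(2)] chi_1 pow by simp
  then have "norm (chi a) = 1" using power_eq_1_iff[of "chi a" "totient q"] n(1) by auto
  then have "\<bar>x\<bar> = 1" by (simp add: x)
  then show ?thesis using x by (auto simp: abs_if split: if_splits)
next
  case False
  then show ?thesis using chi by (auto simp: dirichlet_character_def)
qed

text \<open>The exponent is half of 12.52, and 631 is \<open>632 - 1\<close>, where 632 is the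
  integer part of the square root of 400000.\<close>

lemma exp_le_631: "exp (6.26 :: real) \<le> 631"
proof -
  have "exp (6.26 :: real) = exp 1 ^ 6 * exp 0.26"
    by (simp flip: exp_of_nat_mult exp_add)
  also have "\<dots> \<le> (272 / 100) ^ 6 * (1 / (1 - 0.26))"
  proof (intro mult_mono power_mono)
    show "exp (1 :: real) \<le> 272 / 100" using e_less_272 by simp
    have "1 - 0.26 \<le> exp (- 0.26 :: real)" using exp_ge_add_one_self[of "-0.26 :: real"] by simp
    then show "exp (0.26 :: real) \<le> 1 / (1 - 0.26)" by (simp add: exp_minus field_simps)
  qed auto
  also have "\<dots> \<le> 631" by (simp add: power_divide field_simps)
  finally show ?thesis .
qed

theorem theorem1p2:
  fixes q :: nat and chi :: "int \<Rightarrow> complex"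
  assumes "q > 4 * 10 ^ 5"
    and "primitive_character q chi"
    and "even_character chi"
    and "real_character chi"
  shows "L_one chi \<in> \<real> \<and> Re (L_one chi) \<ge> 12.52 / sqrt (real q)"
proof -
  have chi: "dirichlet_character q chi" using assms(2) by (simp add: primitive_character_def)
  \<comment> \<open>The last branch is reached only when \<open>chi a = -1\<close>, by
    \<open>real_character_values\<close>.\<close>
  define X :: "int \<Rightarrow> int" where "X a = (if chi a = 0 then 0 else if chi a = 1 then 1 else -1)" for a
  have chi_X: "chi a = of_int (X a)" for a
    using real_character_values[OF chi assms(4), of a] by (auto simp: X_def)
  interpret even_primitive_real_character q X
  proof
    show "q > 1" using assms(1) by simp
    show "X (a + int q) = X a" for a
      using dirichlet_character_cong[OF chi, of "a + int q" a] by (simp add: X_def cong_def)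
    show "X (a * b) = X a * X b" for a b
    proof -
      have "chi (a * b) = chi a * chi b" using chi by (simp add: dirichlet_character_def)
      then show ?thesis unfolding chi_X by (simp flip: of_int_mult)
    qed
    show "X a = 0 \<longleftrightarrow> \<not> coprime a (int q)" for a
    proof -
      have "chi a \<noteq> 0 \<longleftrightarrow> coprime a (int q)" using chi unfolding dirichlet_character_def by blast
      then show ?thesis by (auto simp: X_def)
    qed
    show "X a \<in> {-1, 0, 1}" for a by (simp add: X_def)
    show "X (-1) = 1" using assms(3) by (simp add: X_def even_character_def)
    show "\<exists>u. coprime u (int q) \<and> [u = 1] (mod int d) \<and> X u \<noteq> 1" if "d dvd q" "d < q" for d
    proof -
      have "\<nexists>psi. induced_by q chi d psi"
        using assms(2) that(2) by (auto simp: primitive_character_def)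
      from not_induced_imp_nontrivial_kernel[OF chi that(1) this]
      show ?thesis by (auto simp: chi_X)
    qed
  qed
  have "(\<lambda>n. complex_of_real (of_int (X (int (Suc n))) * (1 / Suc n))) sums of_real L"
    using L_sums by (rule sums_of_real)
  then have "(\<lambda>n. chi (int (Suc n)) / of_nat (Suc n)) sums of_real L" by (simp add: chi_X)
  then have L: "L_one chi = of_real L" by (simp add: L_one_def sums_iff)
  \<comment> \<open>The square of 632 is 399424.\<close>
  have "632 ^ 2 \<le> real q" using assms(1) by simp
  then have "632 \<le> sqrt q" by (rule real_le_rsqrt)
  then have "exp 6.26 \<le> sqrt q - 1" using exp_le_631 by linarith
  then have "6.26 \<le> ln (sqrt q - 1)" using \<open>632 \<le> sqrt q\<close> ln_ge_iff[of "sqrt q - 1" "6.26"] by linarith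
  then have "12.52 \<le> sqrt q * L" using L_lower_bound by linarith
  moreover have "sqrt q > 0" using \<open>632 \<le> sqrt q\<close> by linarith
  ultimately have "12.52 / sqrt q \<le> L" by (simp only: pos_divide_le_eq mult.commute)
  then show ?thesis by (simp add: L)
qed

end
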